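(* Let $Y\in\mathbb{C}^{(n\times n)\cdot d}$ and let $f$ be an NC function that is uniformly analytic in a uniformly open neighbourhood of $Y$. Then $f$ has a matrix-centre realization at $Y$: there exist a Hilbert space $\mathcal{H}$, linear maps $A_1,\dots,A_d:\mathbb{C}^{n\times n}\to\mathscr{B}(\mathcal{H})$ and $b,c\in\mathscr{B}(\mathbb{C}^n,\mathcal{H})$ such that $f(X)=(I_m\otimes b^* )L_A(X-I_m\otimes Y)^{-1}(I_m\otimes c)$ for all $X\in\mathbb{C}^{(mn\times mn)\cdot d}$, $m\in\mathbb{N}$, in some uniformly open neighbourhood of $Y$.
   Context: $\mathbb{C}^{(k\times k)\cdot d}$ denotes column $d$-tuples of complex $k\times k$ matrices, normed by $\|X\|_{\mathrm{col}}$ = operator norm of the stacked $kd\times k$ matrix. The uniform topology on $\bigsqcup_k\mathbb{C}^{(k\times k)\cdot d}$ is generated by the sets $\bigsqcup_m\{X\in\mathbb{C}^{(mk\times mk)\cdot d}:\|X-I_m\otimes Z\|_{\mathrm{col}}<r\}$ ($Z\in\mathbb{C}^{(k\times k)\cdot d}$, $r>0$). An NC function on a direct-sum-closed set $\Omega$ is a map $f$ with $f(X)\in\mathbb{C}^{k\times k}$ at level $k$, $f(X\oplus X')=f(X)\oplus f(X')$, and $f(S^{-1}XS)=S^{-1}f(X)S$ whenever $X,S^{-1}XS\in\Omega$; it is uniformly analytic if $\Omega$ is uniformly open and $f$ is locally bounded in the uniform topology. For $X\in\mathbb{C}^{(mn\times mn)\cdot d}$, viewed as $m\times m$ block matrices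 with $n\times n$ blocks, $L_A(X)=I_m\otimes I_{\mathcal{H}}-\sum_j(\mathrm{id}_m\otimes A_j)(X_j)$ where $\mathrm{id}_m\otimes A_j$ applies $A_j$ blockwise. *)

theory Defs
  imports Complex_Main "Jordan_Normal_Form.Matrix"
begin

definition ncpts :: "nat \<Rightarrow> complex mat list set" where
  "ncpts d = {X. length X = d \<and> (\<exists>k>0. \<forall>M\<in>set X. M \<in> carrier_mat k k)}"

definition level :: "complex mat list \<Rightarrow> nat" where
  "level X = dim_row (hd X)"

definition cvnorm :: "complex vec \<Rightarrow> real" where
  "cvnorm v = sqrt (\<Sum>i<dim_vec v. (cmod (v $ i))\<^sup>2)"

text \<open>Column norm: operator norm of the stacked (kd x k) matrix.\<close>
definition colnorm :: "complex mat list \<Rightarrow> real" where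
  "colnorm X = Sup {sqrt (\<Sum>M\<leftarrow>X. (cvnorm (M *\<^sub>v v))\<^sup>2) | v.
                     v \<in> carrier_vec (dim_col (hd X)) \<and> cvnorm v = 1}"

definition opnorm :: "complex mat \<Rightarrow> real" where
  "opnorm M = colnorm [M]"

definition ampl :: "nat \<Rightarrow> complex mat \<Rightarrow> complex mat" where
  "ampl m M = (let k = dim_row M in
     mat (m * k) (m * k) (\<lambda>(p, q). if p div k = q div k then M $$ (p mod k, q mod k) else 0))"

definition tsub :: "complex mat list \<Rightarrow> complex mat list \<Rightarrow> complex mat list" where
  "tsub X Z = map2 (\<lambda>A B. A - B) X Z"

definition ubasic :: "nat \<Rightarrow> complex mat list \<Rightarrow> real \<Rightarrow> complex mat list set" where
  "ubasic d Z r = {X \<in> ncpts d. \<exists>m. level X = m * level Z \<and>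
                     colnorm (tsub X (map (ampl m) Z)) < r}"

definition ubasics :: "nat \<Rightarrow> complex mat list set set" where
  "ubasics d = {ubasic d Z r | Z r. Z \<in> ncpts d \<and> r > 0}"

definition uopen :: "nat \<Rightarrow> complex mat list set \<Rightarrow> bool" where
  "uopen d U \<longleftrightarrow> U \<subseteq> ncpts d \<and> generate_topology (ubasics d) U"

definition dsum_mat :: "complex mat \<Rightarrow> complex mat \<Rightarrow> complex mat" where
  "dsum_mat A B = four_block_mat A (0\<^sub>m (dim_row A) (dim_col B)) (0\<^sub>m (dim_row B) (dim_col A)) B"

definition dsum :: "complex mat list \<Rightarrow> complex mat list \<Rightarrow> complex mat list" where
  "dsum X X' = map2 dsum_mat X X'"

definition nc_function :: "nat \<Rightarrow> complex mat list set \<Rightarrow> (complex mat list \<Rightarrow> complex mat) \<Rightarrow> bool" where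
  "nc_function d \<Omega> f \<longleftrightarrow>
     \<Omega> \<subseteq> ncpts d \<and>
     (\<forall>X\<in>\<Omega>. \<forall>X'\<in>\<Omega>. dsum X X' \<in> \<Omega>) \<and>
     (\<forall>X\<in>\<Omega>. f X \<in> carrier_mat (level X) (level X)) \<and>
     (\<forall>X\<in>\<Omega>. \<forall>X'\<in>\<Omega>. f (dsum X X') = dsum_mat (f X) (f X')) \<and>
     (\<forall>X\<in>\<Omega>. \<forall>S T. S \<in> carrier_mat (level X) (level X) \<and> T \<in> carrier_mat (level X) (level X)
        \<and> S * T = 1\<^sub>m (level X) \<and> T * S = 1\<^sub>m (level X)
        \<and> map (\<lambda>M. T * M * S) X \<in> \<Omega> \<longrightarrow> f (map (\<lambda>M. T * M * S) X) = T * f X * S)"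

definition uniformly_analytic :: "nat \<Rightarrow> complex mat list set \<Rightarrow> (complex mat list \<Rightarrow> complex mat) \<Rightarrow> bool" where
  "uniformly_analytic d \<Omega> f \<longleftrightarrow> nc_function d \<Omega> f \<and> uopen d \<Omega> \<and>
     (\<forall>X\<in>\<Omega>. \<exists>U. uopen d U \<and> X \<in> U \<and> U \<subseteq> \<Omega> \<and> (\<exists>B. \<forall>Z\<in>U. opnorm (f Z) \<le> B))"

definition l2 :: "(nat \<Rightarrow> complex) set" where
  "l2 = {x. summable (\<lambda>i. (cmod (x i))\<^sup>2)}"

definition l2norm :: "(nat \<Rightarrow> complex) \<Rightarrow> real" where
  "l2norm x = sqrt (\<Sum>i. (cmod (x i))\<^sup>2)"

definition l2inner :: "(nat \<Rightarrow> complex) \<Rightarrow> (nat \<Rightarrow> complex) \<Rightarrow> complex" where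
  "l2inner x y = (\<Sum>i. cnj (x i) * y i)"

text \<open>Bounded linear operators on \<ell>^2 (only their values on \<ell>^2 matter).\<close>
definition bounded_op :: "((nat \<Rightarrow> complex) \<Rightarrow> (nat \<Rightarrow> complex)) \<Rightarrow> bool" where
  "bounded_op T \<longleftrightarrow> (\<forall>x\<in>l2. T x \<in> l2) \<and>
     (\<forall>x\<in>l2. \<forall>y\<in>l2. \<forall>a b. T (\<lambda>i. a * x i + b * y i) = (\<lambda>i. a * T x i + b * T y i)) \<and>
     (\<exists>K. \<forall>x\<in>l2. l2norm (T x) \<le> K * l2norm x)"

definition lin_to_ops :: "nat \<Rightarrow> (complex mat \<Rightarrow> (nat \<Rightarrow> complex) \<Rightarrow> (nat \<Rightarrow> complex)) \<Rightarrow> bool" where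
  "lin_to_ops n A \<longleftrightarrow>
     (\<forall>M\<in>carrier_mat n n. bounded_op (A M)) \<and>
     (\<forall>M\<in>carrier_mat n n. \<forall>N\<in>carrier_mat n n. \<forall>a b. \<forall>x\<in>l2.
        A (a \<cdot>\<^sub>m M + b \<cdot>\<^sub>m N) x = (\<lambda>i. a * A M x i + b * A N x i))"

text \<open>The space \<ell>^2 \<otimes> C^m = (\<ell>^2)^m: vectors indexed by slot s < m, zero in other slots.\<close>
definition l2m :: "nat \<Rightarrow> (nat \<Rightarrow> nat \<Rightarrow> complex) set" where
  "l2m m = {v. (\<forall>s<m. v s \<in> l2) \<and> (\<forall>s\<ge>m. v s = (\<lambda>_. 0))}"

definition blk :: "nat \<Rightarrow> complex mat \<Rightarrow> nat \<Rightarrow> nat \<Rightarrow> complex mat" where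
  "blk n M s t = mat n n (\<lambda>(p, q). M $$ (s * n + p, t * n + q))"

text \<open>L_A(Z) = I - \<Sum>_j (id_m \<otimes> A_j)(Z_j) acting on (\<ell>^2)^m, for Z of level m*n.\<close>
definition LA :: "nat \<Rightarrow> nat \<Rightarrow> (nat \<Rightarrow> complex mat \<Rightarrow> (nat \<Rightarrow> complex) \<Rightarrow> (nat \<Rightarrow> complex))
                 \<Rightarrow> nat \<Rightarrow> complex mat list \<Rightarrow> (nat \<Rightarrow> nat \<Rightarrow> complex) \<Rightarrow> (nat \<Rightarrow> nat \<Rightarrow> complex)" where
  "LA d n A m Z v = (\<lambda>s. if s < m then
      (\<lambda>i. v s i - (\<Sum>j<d. \<Sum>t<m. A j (blk n (Z ! j) s t) (v t) i))
     else (\<lambda>_. 0))"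

definition slot :: "nat \<Rightarrow> (nat \<Rightarrow> complex) \<Rightarrow> (nat \<Rightarrow> nat \<Rightarrow> complex)" where
  "slot t h = (\<lambda>s. if s = t then h else (\<lambda>_. 0))"

text \<open>Realization formula: b, c : C^n \<rightarrow> \<ell>^2 given by the images of the standard basis vectors;
  entry (s*n+k, t*n+l) of (I_m \<otimes> b*) L_A(Z)^{-1} (I_m \<otimes> c) is <b e_k, (L_A(Z)^{-1}(c e_l in slot t)) in slot s>.\<close>
definition realization :: "nat \<Rightarrow> nat \<Rightarrow> (nat \<Rightarrow> complex mat \<Rightarrow> (nat \<Rightarrow> complex) \<Rightarrow> (nat \<Rightarrow> complex))
     \<Rightarrow> (nat \<Rightarrow> nat \<Rightarrow> complex) \<Rightarrow> (nat \<Rightarrow> nat \<Rightarrow> complex) \<Rightarrow> nat \<Rightarrow> complex mat list \<Rightarrow> complex mat" where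
  "realization d n A b c m Z = mat (m * n) (m * n) (\<lambda>(p, q).
      l2inner (b (p mod n))
        ((the_inv_into (l2m m) (LA d n A m Z) (slot (q div n) (c (q mod n)))) (p div n)))"

end

(* Let N = d n^2, and index letters by triples (j, p, q) with j < d and p, q < n, so that a point
   X = I (x) Y + Z of level m n is given by N matrices Z_(j,p,q) of size m. On the Fock space over the N
   letters (tensored with C^n) let A be the creation operators scaled by 1/rho and c the vacuum vectors;
   then v = L_A(Z)^(-1) c is found by recursion over words, v_(g w) = (1/rho) Z_g v_w, and is
   square-summable when Z is small. The vectors b are read off the values of f at the truncations to
   finitely many words of the universal point I (x) Y + rho (creation operators), where f is bounded.

   No Taylor series is needed to see that f(X) = b* v. Values of f respect intertwinings (X T = T X'
   implies f(X) T = T f(X')). Adjoin C^m to the truncated Fock space and send every discarded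
   word w into C^m as v_w / eps, where eps is the l2-norm of the discarded tail of v. The resulting
   point G is still in the ball where f is bounded, and T = [v, eps I] satisfies X T = T G.
   Hence f(X) T = T f(G), which says that f(X) is the partial sum of b* v up to an error O(eps). *)

theory Submission
  imports Defs "HOL-Analysis.L2_Norm"
begin

section \<open>Column norms\<close>

text \<open>A centre of size \<open>n\<close> is harder than a scalar one because an intertwiner
  must also respect \<open>I (x) Y\<close>. Those of the form \<open>T (x) I_n\<close> do so
  whatever \<open>Y\<close> is, and no others are used. The letters therefore absorb the matrix
  units \<open>(p, q)\<close>, and a single column of \<open>f(X)\<close> is reached from all
  \<open>n\<close> vacua at once, through the vector \<open>sum_l e_l (x) e_l\<close>. The augmented
  point stays in a fixed ball for the following reason. Its new block has entries
  \<open>\<rho> / \<epsilon>\<close> times discarded entries of \<open>v\<close>, each occurring at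
  most once, so its Hilbert-Schmidt norm is at most \<open>\<rho>\<close> however late the cut is
  made. Division by \<open>\<epsilon>\<close> normalises the tail, and the same
  \<open>\<epsilon>\<close> returns as a factor in front of the uncontrolled part of
  \<open>f(G)\<close>. This trade lets one bound for \<open>f\<close> on one ball replace estimates
  of individual homogeneous terms.\<close>

lemma cauchy_schwarz_cmod:
  fixes a b :: "'i \<Rightarrow> complex"
  shows "(cmod (\<Sum>i\<in>I. a i * b i))\<^sup>2 \<le> (\<Sum>i\<in>I. (cmod (a i))\<^sup>2) * (\<Sum>i\<in>I. (cmod (b i))\<^sup>2)"
proof -
  have "cmod (\<Sum>i\<in>I. a i * b i) \<le> (\<Sum>i\<in>I. \<bar>cmod (a i)\<bar> * \<bar>cmod (b i)\<bar>)"
    by (rule order_trans[OF norm_sum]) (simp add: norm_mult)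
  also have "\<dots> \<le> L2_set (\<lambda>i. cmod (a i)) I * L2_set (\<lambda>i. cmod (b i)) I"
    by (rule L2_set_mult_ineq)
  finally have "(cmod (\<Sum>i\<in>I. a i * b i))\<^sup>2 \<le> (L2_set (\<lambda>i. cmod (a i)) I * L2_set (\<lambda>i. cmod (b i)) I)\<^sup>2"
    by (intro power_mono) auto
  thus ?thesis by (simp add: power_mult_distrib L2_set_def sum_nonneg)
qed

lemma sum_lessThan_mult:
  fixes g :: "nat \<Rightarrow> 'a::comm_monoid_add"
  shows "sum g {..<a * b} = (\<Sum>i<a. \<Sum>j<b. g (i * b + j))"
proof -
  have "sum g {..<a * b} = (\<Sum>i<a. sum g {i * b..<i * b + b})"
    by (rule sum.nat_group[symmetric])
  also have "\<dots> = (\<Sum>i<a. \<Sum>j<b. g (i * b + j))"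
    using sum.shift_bounds_nat_ivl[of g 0 "_ * b" b] by (simp add: lessThan_atLeast0 add.commute)
  finally show ?thesis .
qed

lemma mult_add_less:
  fixes a p m n :: nat
  assumes "a < m" "p < n" shows "a * n + p < m * n"
proof -
  have "a * n + p < (a + 1) * n" using assms by simp
  also have "\<dots> \<le> m * n" using assms by (intro mult_right_mono) auto
  finally show ?thesis .
qed

lemma cvnorm_sq: "(cvnorm v)\<^sup>2 = (\<Sum>i<dim_vec v. (cmod (v $ i))\<^sup>2)"
  by (simp add: cvnorm_def sum_nonneg)

lemma cvnorm_nonneg [simp]: "0 \<le> cvnorm v"
  by (simp add: cvnorm_def sum_nonneg)

lemma cvnorm_smult: "cvnorm (a \<cdot>\<^sub>v v) = cmod a * cvnorm v"
  by (simp add: cvnorm_def norm_mult power_mult_distrib sum_distrib_left[symmetric] real_sqrt_mult)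

lemma cvnorm_L2_set: "cvnorm v = L2_set (\<lambda>i. cmod (v $ i)) {..<dim_vec v}"
  by (simp add: cvnorm_def L2_set_def)

lemma cvnorm_add:
  assumes "u \<in> carrier_vec k" "v \<in> carrier_vec k"
  shows "cvnorm (u + v) \<le> cvnorm u + cvnorm v"
proof -
  have "cvnorm (u + v) \<le> L2_set (\<lambda>i. cmod (u $ i) + cmod (v $ i)) {..<k}"
    using assms unfolding cvnorm_L2_set by (auto intro!: L2_set_mono norm_triangle_ineq)
  also have "\<dots> \<le> cvnorm u + cvnorm v"
    using assms unfolding cvnorm_L2_set by (simp add: L2_set_triangle_ineq)
  finally show ?thesis .
qed

lemma cvnorm_mult_frobenius:
  assumes "M \<in> carrier_mat nr nc" "v \<in> carrier_vec nc"
  shows "(cvnorm (M *\<^sub>v v))\<^sup>2 \<le> (\<Sum>i<nr. \<Sum>j<nc. (cmod (M $$ (i, j)))\<^sup>2) * (cvnorm v)\<^sup>2"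
proof -
  have "(cvnorm (M *\<^sub>v v))\<^sup>2 = (\<Sum>i<nr. (cmod (\<Sum>j<nc. M $$ (i, j) * v $ j))\<^sup>2)"
    using assms by (simp add: cvnorm_sq scalar_prod_def lessThan_atLeast0)
  also have "\<dots> \<le> (\<Sum>i<nr. (\<Sum>j<nc. (cmod (M $$ (i, j)))\<^sup>2) * (\<Sum>j<nc. (cmod (v $ j))\<^sup>2))"
    by (intro sum_mono cauchy_schwarz_cmod)
  also have "\<dots> = (\<Sum>i<nr. \<Sum>j<nc. (cmod (M $$ (i, j)))\<^sup>2) * (cvnorm v)\<^sup>2"
    using assms by (simp add: cvnorm_sq sum_distrib_right)
  finally show ?thesis .
qed

text \<open>Homogeneous form of \<open>colnorm X \<le> r\<close>: with all vectors in place of a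
  supremum over unit ones, estimates become rearrangements of sums of squares.
  \<open>colnorm_le\<close> and \<open>colbd_colnorm\<close> translate back and forth.\<close>

definition colbd :: "complex mat list \<Rightarrow> real \<Rightarrow> bool" where
  "colbd X r \<longleftrightarrow> (\<forall>v\<in>carrier_vec (dim_col (hd X)). (\<Sum>M\<leftarrow>X. (cvnorm (M *\<^sub>v v))\<^sup>2) \<le> r\<^sup>2 * (cvnorm v)\<^sup>2)"

lemma sum_list_sq_nonneg: "0 \<le> (\<Sum>M\<leftarrow>X. (g M)\<^sup>2)" for g :: "'a \<Rightarrow> real"
  by (rule sum_list_nonneg) auto

lemma cvnorm_unit_vec: "0 < k \<Longrightarrow> cvnorm (unit_vec k 0) = 1"
proof -
  assume "0 < k"
  have "(\<Sum>i<k. (cmod (unit_vec k 0 $ i))\<^sup>2) = (\<Sum>i<k. if i = 0 then 1 else 0)"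
    by (intro sum.cong) auto
  thus ?thesis using \<open>0 < k\<close> by (simp add: cvnorm_def)
qed

lemma colnorm_le:
  assumes "0 < dim_col (hd X)" "0 \<le> r" "colbd X r"
  shows "colnorm X \<le> r"
  unfolding colnorm_def
proof (rule cSup_least)
  show "{sqrt (\<Sum>M\<leftarrow>X. (cvnorm (M *\<^sub>v v))\<^sup>2) |v. v \<in> carrier_vec (dim_col (hd X)) \<and> cvnorm v = 1} \<noteq> {}"
    using cvnorm_unit_vec[OF assms(1)] unit_vec_carrier by blast
next
  fix y assume "y \<in> {sqrt (\<Sum>M\<leftarrow>X. (cvnorm (M *\<^sub>v v))\<^sup>2) |v. v \<in> carrier_vec (dim_col (hd X)) \<and> cvnorm v = 1}"
  then obtain v where v: "v \<in> carrier_vec (dim_col (hd X))" "cvnorm v = 1"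
    and y: "y = sqrt (\<Sum>M\<leftarrow>X. (cvnorm (M *\<^sub>v v))\<^sup>2)" by auto
  have "(\<Sum>M\<leftarrow>X. (cvnorm (M *\<^sub>v v))\<^sup>2) \<le> r\<^sup>2"
    using assms(3) v unfolding colbd_def by force
  thus "y \<le> r" using y assms(2) by (simp add: real_le_lsqrt)
qed

text \<open>The Frobenius bound makes the set under \<open>Sup\<close> bounded above, so that the
  supremum is a genuine upper bound; the rest is scaling to unit length.\<close>

lemma colbd_colnorm:
  assumes X: "\<forall>M\<in>set X. M \<in> carrier_mat k k" "X \<noteq> []" "0 < k"
  shows "0 \<le> colnorm X" "colbd X (colnorm X)"
proof -
  let ?S = "{sqrt (\<Sum>M\<leftarrow>X. (cvnorm (M *\<^sub>v v))\<^sup>2) |v. v \<in> carrier_vec (dim_col (hd X)) \<and> cvnorm v = 1}"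
  define C where "C = (\<Sum>M\<leftarrow>X. \<Sum>i<k. \<Sum>j<k. (cmod (M $$ (i, j)))\<^sup>2)"
  have dc: "dim_col (hd X) = k" using X by (cases X) auto
  have frob: "(\<Sum>M\<leftarrow>X. (cvnorm (M *\<^sub>v v))\<^sup>2) \<le> C * (cvnorm v)\<^sup>2" if "v \<in> carrier_vec k" for v
  proof -
    have "(\<Sum>M\<leftarrow>X. (cvnorm (M *\<^sub>v v))\<^sup>2) \<le> (\<Sum>M\<leftarrow>X. (\<Sum>i<k. \<Sum>j<k. (cmod (M $$ (i, j)))\<^sup>2) * (cvnorm v)\<^sup>2)"
      using X that by (intro sum_list_mono cvnorm_mult_frobenius) auto
    thus ?thesis by (simp add: C_def sum_list_mult_const)
  qed
  have bdd: "bdd_above ?S"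
    by (rule bdd_aboveI[of _ "sqrt C"]) (use frob dc in \<open>fastforce intro: real_sqrt_le_mono\<close>)
  have up: "sqrt (\<Sum>M\<leftarrow>X. (cvnorm (M *\<^sub>v v))\<^sup>2) \<le> colnorm X" if "v \<in> carrier_vec k" "cvnorm v = 1" for v
    unfolding colnorm_def by (rule cSup_upper[OF _ bdd]) (use that dc in auto)
  show nn: "0 \<le> colnorm X"
    using up[of "unit_vec k 0"] cvnorm_unit_vec[OF X(3)] sum_list_sq_nonneg[of "\<lambda>M. cvnorm (M *\<^sub>v unit_vec k 0)" X]
    by (meson order_trans real_sqrt_ge_zero unit_vec_carrier)
  show "colbd X (colnorm X)"
    unfolding colbd_def dc
  proof
    fix v :: "complex vec" assume v: "v \<in> carrier_vec k"
    show "(\<Sum>M\<leftarrow>X. (cvnorm (M *\<^sub>v v))\<^sup>2) \<le> (colnorm X)\<^sup>2 * (cvnorm v)\<^sup>2"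
    proof (cases "cvnorm v = 0")
      \<comment> \<open>A null vector cannot be normalised, but the Frobenius estimate already
        forces the left side to vanish.\<close>
      case True
      thus ?thesis using frob[OF v] by simp
    next
      case False
      define c where "c = cvnorm v"
      define w where "w = complex_of_real (1 / c) \<cdot>\<^sub>v v"
      have c: "c > 0" using False cvnorm_nonneg[of v] unfolding c_def by linarith
      have w: "w \<in> carrier_vec k" "cvnorm w = 1"
        using v c by (auto simp: w_def cvnorm_smult norm_divide c_def)
      have "(\<Sum>M\<leftarrow>X. (cvnorm (M *\<^sub>v w))\<^sup>2) = (\<Sum>M\<leftarrow>X. (1 / c)\<^sup>2 * (cvnorm (M *\<^sub>v v))\<^sup>2)"
      proof (rule arg_cong[where f = sum_list], rule map_cong[OF refl])
        fix M assume "M \<in> set X"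
        hence "M *\<^sub>v w = complex_of_real (1 / c) \<cdot>\<^sub>v (M *\<^sub>v v)"
          unfolding w_def using X v by (intro mult_mat_vec) auto
        thus "(cvnorm (M *\<^sub>v w))\<^sup>2 = (1 / c)\<^sup>2 * (cvnorm (M *\<^sub>v v))\<^sup>2"
          using c by (simp add: cvnorm_smult norm_divide power_mult_distrib power_divide)
      qed
      hence eq: "(\<Sum>M\<leftarrow>X. (cvnorm (M *\<^sub>v w))\<^sup>2) = (1 / c)\<^sup>2 * (\<Sum>M\<leftarrow>X. (cvnorm (M *\<^sub>v v))\<^sup>2)"
        by (simp add: sum_list_const_mult)
      have "(\<Sum>M\<leftarrow>X. (cvnorm (M *\<^sub>v w))\<^sup>2) \<le> (colnorm X)\<^sup>2"
        using up[OF w] sum_list_sq_nonneg[of "\<lambda>M. cvnorm (M *\<^sub>v w)" X]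
        by (metis nn real_sqrt_ge_zero real_sqrt_pow2 power_mono)
      thus ?thesis using c unfolding eq c_def[symmetric] by (simp add: field_simps)
    qed
  qed
qed

lemma colbd_mono: "colbd X r \<Longrightarrow> 0 \<le> r \<Longrightarrow> r \<le> s \<Longrightarrow> colbd X s"
  unfolding colbd_def by (meson mult_right_mono order_trans power_mono zero_le_power2)

section \<open>The uniform topology\<close>

text \<open>Triangle inequality in each component, then Minkowski for the component norms collected
  in \<open>P\<close>.\<close>

lemma colbd_add:
  assumes len: "length X = length X'" "X \<noteq> []" "0 \<le> r" "0 \<le> s"
    and X: "\<forall>M\<in>set X. M \<in> carrier_mat k k" and X': "\<forall>M\<in>set X'. M \<in> carrier_mat k k"
    and bd: "colbd X r" "colbd X' s"
  shows "colbd (map2 (+) X X') (r + s)"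
  unfolding colbd_def
proof
  let ?d = "length X"
  have dc: "dim_col (hd X) = k" "dim_col (hd X') = k" "dim_col (hd (map2 (+) X X')) = k"
    using len X X' by (cases X; cases X'; auto)+
  have Xi: "X ! i \<in> carrier_mat k k" "X' ! i \<in> carrier_mat k k" if "i < ?d" for i
    using that X X' len by auto
  have sums: "(\<Sum>M\<leftarrow>Z. (cvnorm (M *\<^sub>v v))\<^sup>2) = (\<Sum>i<?d. (cvnorm ((Z ! i) *\<^sub>v v))\<^sup>2)"
    if "length Z = ?d" for Z and v :: "complex vec"
    using that by (simp add: sum_list_sum_nth lessThan_atLeast0)
  fix v :: "complex vec" assume "v \<in> carrier_vec (dim_col (hd (map2 (+) X X')))"
  hence v: "v \<in> carrier_vec k" by (simp add: dc)
  define P where "P Z = L2_set (\<lambda>i. cvnorm ((Z ! i) *\<^sub>v v)) {..<?d}" for Z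
  have Psq: "(P Z)\<^sup>2 = (\<Sum>M\<leftarrow>Z. (cvnorm (M *\<^sub>v v))\<^sup>2)" if "length Z = ?d" for Z
    unfolding sums[OF that] P_def L2_set_def by (simp add: sum_nonneg)
  have "(\<Sum>M\<leftarrow>X. (cvnorm (M *\<^sub>v v))\<^sup>2) \<le> r\<^sup>2 * (cvnorm v)\<^sup>2"
    "(\<Sum>M\<leftarrow>X'. (cvnorm (M *\<^sub>v v))\<^sup>2) \<le> s\<^sup>2 * (cvnorm v)\<^sup>2"
    using bd v unfolding colbd_def dc by blast+
  hence "(P X)\<^sup>2 \<le> (r * cvnorm v)\<^sup>2" "(P X')\<^sup>2 \<le> (s * cvnorm v)\<^sup>2"
    using Psq[of X] Psq[of X'] len(1) by (simp_all only: power_mult_distrib)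
  hence le: "P X \<le> r * cvnorm v" "P X' \<le> s * cvnorm v"
    using assms(3,4) by (auto intro: power2_le_imp_le)
  have "P (map2 (+) X X') \<le> L2_set (\<lambda>i. cvnorm ((X ! i) *\<^sub>v v) + cvnorm ((X' ! i) *\<^sub>v v)) {..<?d}"
    unfolding P_def
  proof (rule L2_set_mono)
    fix i assume i: "i \<in> {..<?d}"
    have "(map2 (+) X X' ! i) *\<^sub>v v = (X ! i) *\<^sub>v v + (X' ! i) *\<^sub>v v"
      using i len Xi[of i] v by (simp add: add_mult_distrib_mat_vec)
    thus "cvnorm ((map2 (+) X X' ! i) *\<^sub>v v) \<le> cvnorm ((X ! i) *\<^sub>v v) + cvnorm ((X' ! i) *\<^sub>v v)"
      using i Xi[of i] v by (auto intro!: cvnorm_add[of _ k] simp: mult_mat_vec_carrier)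
  qed simp
  also have "\<dots> \<le> P X + P X'" unfolding P_def by (rule L2_set_triangle_ineq)
  also have "\<dots> \<le> (r + s) * cvnorm v" using le by (simp add: distrib_right)
  finally have "(P (map2 (+) X X'))\<^sup>2 \<le> ((r + s) * cvnorm v)\<^sup>2"
    by (intro power_mono) (auto simp: P_def)
  thus "(\<Sum>M\<leftarrow>map2 (+) X X'. (cvnorm (M *\<^sub>v v))\<^sup>2) \<le> (r + s)\<^sup>2 * (cvnorm v)\<^sup>2"
    using len by (subst (asm) Psq) (simp_all add: power_mult_distrib)
qed

lemma ampl_carrier: "M \<in> carrier_mat k k \<Longrightarrow> ampl m M \<in> carrier_mat (m * k) (m * k)"
  by (simp add: ampl_def Let_def)

lemma cvnorm_ampl_mult:
  assumes M: "M \<in> carrier_mat k k" and v: "v \<in> carrier_vec (m * k)"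
  shows "(cvnorm (ampl m M *\<^sub>v v))\<^sup>2 = (\<Sum>a<m. (cvnorm (M *\<^sub>v vec k (\<lambda>p. v $ (a * k + p))))\<^sup>2)"
proof -
  have "(cvnorm (ampl m M *\<^sub>v v))\<^sup>2 = (\<Sum>x<m * k. (cmod (\<Sum>y<m * k. ampl m M $$ (x, y) * v $ y))\<^sup>2)"
    using M v by (simp add: cvnorm_sq scalar_prod_def lessThan_atLeast0 ampl_def Let_def)
  also have "\<dots> = (\<Sum>a<m. \<Sum>p<k. (cmod (\<Sum>b<m. \<Sum>q<k. ampl m M $$ (a * k + p, b * k + q) * v $ (b * k + q)))\<^sup>2)"
    by (simp add: sum_lessThan_mult)
  also have "\<dots> = (\<Sum>a<m. \<Sum>p<k. (cmod (\<Sum>q<k. M $$ (p, q) * v $ (a * k + q)))\<^sup>2)"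
  proof (intro sum.cong refl)
    fix a p assume a: "a \<in> {..<m}" and p: "p \<in> {..<k}"
    have "(\<Sum>q<k. ampl m M $$ (a * k + p, b * k + q) * v $ (b * k + q))
        = (if b = a then (\<Sum>q<k. M $$ (p, q) * v $ (b * k + q)) else 0)" if "b < m" for b
      using M a p that by (cases "b = a") (simp_all add: ampl_def Let_def mult_add_less)
    hence "(\<Sum>b<m. \<Sum>q<k. ampl m M $$ (a * k + p, b * k + q) * v $ (b * k + q))
        = (\<Sum>b<m. if b = a then (\<Sum>q<k. M $$ (p, q) * v $ (b * k + q)) else 0)"
      by (intro sum.cong) auto
    thus "(cmod (\<Sum>b<m. \<Sum>q<k. ampl m M $$ (a * k + p, b * k + q) * v $ (b * k + q)))\<^sup>2
        = (cmod (\<Sum>q<k. M $$ (p, q) * v $ (a * k + q)))\<^sup>2"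
      using a by simp
  qed
  also have "\<dots> = (\<Sum>a<m. (cvnorm (M *\<^sub>v vec k (\<lambda>p. v $ (a * k + p))))\<^sup>2)"
    using M by (simp add: cvnorm_sq scalar_prod_def lessThan_atLeast0)
  finally show ?thesis .
qed

text \<open>\<open>ampl m M\<close> acts separately on the \<open>m\<close> consecutive blocks of
  \<open>v\<close>, whose squared norms add up to that of \<open>v\<close>, so the bound for one
  block carries over unchanged.\<close>

lemma colbd_ampl:
  assumes X: "\<forall>M\<in>set X. M \<in> carrier_mat k k" "X \<noteq> []" and bd: "colbd X r"
  shows "colbd (map (ampl m) X) r"
  unfolding colbd_def
proof
  have dc: "dim_col (hd X) = k" using X by (cases X) auto
  have dc': "dim_col (hd (map (ampl m) X)) = m * k" using X ampl_carrier by (cases X) auto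
  fix v :: "complex vec" assume "v \<in> carrier_vec (dim_col (hd (map (ampl m) X)))"
  hence v: "v \<in> carrier_vec (m * k)" unfolding dc' .
  define w where "w a = vec k (\<lambda>p. v $ (a * k + p))" for a
  have "(\<Sum>M\<leftarrow>map (ampl m) X. (cvnorm (M *\<^sub>v v))\<^sup>2) = (\<Sum>M\<leftarrow>X. (cvnorm (ampl m M *\<^sub>v v))\<^sup>2)"
    by (simp add: o_def)
  also have "\<dots> = (\<Sum>M\<leftarrow>X. \<Sum>a<m. (cvnorm (M *\<^sub>v w a))\<^sup>2)"
    using X v by (intro arg_cong[where f = sum_list] map_cong refl) (simp add: cvnorm_ampl_mult w_def)
  also have "\<dots> = (\<Sum>a<m. \<Sum>M\<leftarrow>X. (cvnorm (M *\<^sub>v w a))\<^sup>2)"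
    by (induction X) (simp_all add: sum.distrib)
  also have "\<dots> \<le> (\<Sum>a<m. r\<^sup>2 * (cvnorm (w a))\<^sup>2)"
    using bd dc by (intro sum_mono) (auto simp: colbd_def w_def)
  also have "\<dots> = r\<^sup>2 * (cvnorm v)\<^sup>2"
    using v by (simp add: sum_distrib_left[symmetric] cvnorm_sq w_def sum_lessThan_mult)
  finally show "(\<Sum>M\<leftarrow>map (ampl m) X. (cvnorm (M *\<^sub>v v))\<^sup>2) \<le> r\<^sup>2 * (cvnorm v)\<^sup>2" .
qed

lemma ncptsE:
  assumes "X \<in> ncpts d" "0 < d"
  obtains k where "0 < k" "length X = d" "level X = k" "X \<noteq> []" "\<forall>M\<in>set X. M \<in> carrier_mat k k"
proof -
  from assms obtain k where "length X = d" "k > 0" "\<forall>M\<in>set X. M \<in> carrier_mat k k"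
    by (auto simp: ncpts_def)
  moreover from this assms have "X \<noteq> []" "level X = k" by (cases X; auto simp: level_def)+
  ultimately show ?thesis using that by blast
qed

lemma ampl_ampl:
  assumes "M \<in> carrier_mat k k" "0 < k"
  shows "ampl m (ampl l M) = ampl (m * l) M"
proof (rule eq_matI)
  fix i j assume "i < dim_row (ampl (m * l) M)" "j < dim_col (ampl (m * l) M)"
  hence ij: "i < m * l * k" "j < m * l * k" using assms by (auto simp: ampl_def Let_def)
  have lk: "0 < l * k" using ij by (cases l) auto
  have 1: "i div (l * k) = i div k div l" for i using div_mult2_eq[of i k l] by (simp add: mult.commute)
  have 2: "i mod (l * k) div k = i div k mod l" for i
    using mod_mult2_eq[of i k l] assms by (simp add: mult.commute)
  have 3: "i mod (l * k) mod k = i mod k" for i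
    by (simp add: mod_mod_cancel)
  have eq: "i div k = j div k \<longleftrightarrow> i div k div l = j div k div l \<and> i div k mod l = j div k mod l"
    by (metis div_mult_mod_eq)
  show "ampl m (ampl l M) $$ (i, j) = ampl (m * l) M $$ (i, j)"
    using assms ij lk eq by (auto simp: ampl_def Let_def mult.assoc 1 2 3)
qed (use assms in \<open>auto simp: ampl_def Let_def mult.assoc\<close>)

lemma tsub_carrier:
  assumes "\<forall>M\<in>set X'. M \<in> carrier_mat k k"
  shows "\<forall>M\<in>set (tsub X X'). M \<in> carrier_mat k k"
  using assms by (auto simp: tsub_def dest!: set_zip_rightD intro: minus_carrier_mat)

lemma ubasic_mono: "r \<le> s \<Longrightarrow> ubasic d Z r \<subseteq> ubasic d Z s"
  unfolding ubasic_def by fastforce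

text \<open>Recentring rests on the splitting
  \<open>W - I (x) Z = (W - I (x) X) + I (x) (X - I (x) Z)\<close>, where amplification does not
  enlarge the second term. The radius \<open>s\<close> is what the distance of \<open>X\<close> from
  the old centre leaves of \<open>r\<close>.\<close>

lemma ubasic_centre:
  assumes d: "0 < d" and X: "X \<in> ubasic d Z r" and Z: "Z \<in> ncpts d"
  shows "\<exists>s>0. ubasic d X s \<subseteq> ubasic d Z r"
proof -
  obtain m where m: "level X = m * level Z" and lt: "colnorm (tsub X (map (ampl m) Z)) < r"
    and Xn: "X \<in> ncpts d" using X by (auto simp: ubasic_def)
  from Xn d obtain k where k: "0 < k" "length X = d" "level X = k" "X \<noteq> []" "\<forall>M\<in>set X. M \<in> carrier_mat k k"
    by (rule ncptsE)
  from Z d obtain l where l: "0 < l" "length Z = d" "level Z = l" "Z \<noteq> []" "\<forall>M\<in>set Z. M \<in> carrier_mat l l"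
    by (rule ncptsE)
  define D where "D = tsub X (map (ampl m) Z)"
  have mZ: "\<forall>M\<in>set (map (ampl m) Z). M \<in> carrier_mat k k"
    using l(5) m k(3) l(3) by (auto intro: ampl_carrier)
  have D: "\<forall>M\<in>set D. M \<in> carrier_mat k k" "D \<noteq> []" "length D = d"
    using tsub_carrier[OF mZ] k l d by (auto simp: D_def tsub_def)
  note cD = colbd_colnorm[OF D(1,2) k(1)]
  define s where "s = r - colnorm D"
  have "s > 0" using lt by (simp add: s_def D_def)
  moreover have "W \<in> ubasic d Z r" if W: "W \<in> ubasic d X s" for W
  proof -
    obtain m' where m': "level W = m' * level X" and lt': "colnorm (tsub W (map (ampl m') X)) < s"
      and Wn: "W \<in> ncpts d" using W by (auto simp: ubasic_def)
    from Wn d obtain h where h: "0 < h" "length W = d" "level W = h" "W \<noteq> []" "\<forall>M\<in>set W. M \<in> carrier_mat h h"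
      by (rule ncptsE)
    define E where "E = tsub W (map (ampl m') X)"
    have mX: "\<forall>M\<in>set (map (ampl m') X). M \<in> carrier_mat h h"
      using k h m' by (auto intro: ampl_carrier)
    have E: "\<forall>M\<in>set E. M \<in> carrier_mat h h" "E \<noteq> []" "length E = d"
      using tsub_carrier[OF mX] k h d by (auto simp: E_def tsub_def)
    note cE = colbd_colnorm[OF E(1,2) h(1)]
    have mD: "\<forall>M\<in>set (map (ampl m') D). M \<in> carrier_mat h h"
      using D h m' k by (auto intro: ampl_carrier)
    have "colbd (map2 (+) E (map (ampl m') D)) (colnorm E + colnorm D)"
      using E D by (intro colbd_add[where k = h] cE cD colbd_ampl[OF D(1,2)] mD) auto
    also have "map2 (+) E (map (ampl m') D) = tsub W (map (ampl (m' * m)) Z)"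
    proof (rule nth_equalityI)
      fix i assume "i < length (map2 (+) E (map (ampl m') D))"
      hence i: "i < d" using E D by simp
      have c: "W ! i \<in> carrier_mat h h" "X ! i \<in> carrier_mat k k" "Z ! i \<in> carrier_mat l l"
        using i h k l by auto
      have hk: "h = m' * k" "k = m * l" using m m' h k l by auto
      have "ampl m' (X ! i - ampl m (Z ! i)) = ampl m' (X ! i) - ampl m' (ampl m (Z ! i))"
        using c hk k(1) by (auto intro!: eq_matI simp: ampl_def Let_def mult.assoc)
      moreover have "ampl m' (ampl m (Z ! i)) = ampl (m' * m) (Z ! i)"
        using c(3) l(1) by (rule ampl_ampl)
      moreover have "W ! i - ampl m' (X ! i) + (ampl m' (X ! i) - ampl (m' * m) (Z ! i)) = W ! i - ampl (m' * m) (Z ! i)"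
        using c hk by (auto intro!: eq_matI simp: ampl_def Let_def mult.assoc)
      ultimately show "map2 (+) E (map (ampl m') D) ! i = tsub W (map (ampl (m' * m)) Z) ! i"
        using i h k l E D by (simp add: E_def D_def tsub_def)
    qed (use h l E D in \<open>auto simp: tsub_def\<close>)
    finally have "colbd (tsub W (map (ampl (m' * m)) Z)) (colnorm E + colnorm D)" .
    moreover have "dim_col (hd (tsub W (map (ampl (m' * m)) Z))) = h"
    proof -
      have "\<forall>M\<in>set (map (ampl (m' * m)) Z). M \<in> carrier_mat h h"
        using l(5) ampl_carrier[of _ l "m' * m"] m m' h(3) k(3) l(3) by (simp add: mult.assoc)
      from tsub_carrier[OF this] have "\<forall>M\<in>set (tsub W (map (ampl (m' * m)) Z)). M \<in> carrier_mat h h" .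
      moreover have "tsub W (map (ampl (m' * m)) Z) \<noteq> []" using h l d by (auto simp: tsub_def)
      ultimately show ?thesis using hd_in_set by (metis carrier_matD(2))
    qed
    ultimately have "colnorm (tsub W (map (ampl (m' * m)) Z)) \<le> colnorm E + colnorm D"
      using h(1) cE cD by (intro colnorm_le) auto
    also have "\<dots> < r" using lt' by (simp add: s_def E_def)
    finally show ?thesis using Wn m m' by (auto simp: ubasic_def mult.assoc)
  qed
  ultimately show ?thesis by blast
qed

text \<open>Balls about one common centre are nested, so once every basic set is recentred at
  \<open>X\<close>, an intersection costs only a minimum of radii.\<close>

lemma uopen_ball:
  assumes d: "0 < d" and U: "uopen d U" and X: "X \<in> U"
  shows "\<exists>r>0. ubasic d X r \<subseteq> U"
proof -
  have "generate_topology (ubasics d) U" using U by (simp add: uopen_def)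
  thus ?thesis using X
  proof (induction rule: generate_topology.induct)
    case UNIV
    thus ?case by (auto intro: exI[of _ 1])
  next
    case (Int a b)
    then obtain r s where "r > 0" "ubasic d X r \<subseteq> a" "s > 0" "ubasic d X s \<subseteq> b" by auto
    thus ?case using ubasic_mono[of "min r s" r d X] ubasic_mono[of "min r s" s d X]
      by (intro exI[of _ "min r s"]) auto
  next
    case (UN K)
    thus ?case by blast
  next
    case (Basis s)
    then obtain Z r where "s = ubasic d Z r" "Z \<in> ncpts d" by (auto simp: ubasics_def)
    thus ?case using ubasic_centre[OF d, of X Z r] Basis by auto
  qed
qed

section \<open>Intertwinings\<close>

lemma dsum_mat_carrier:
  "A \<in> carrier_mat k k \<Longrightarrow> B \<in> carrier_mat l l \<Longrightarrow> dsum_mat A B \<in> carrier_mat (k + l) (k + l)"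
  by (simp add: dsum_mat_def)

lemma dsum_mat_mult_unipotent:
  assumes "A \<in> carrier_mat k k" "B \<in> carrier_mat l l" "T \<in> carrier_mat k l"
  shows "dsum_mat A B * four_block_mat (1\<^sub>m k) T (0\<^sub>m l k) (1\<^sub>m l) = four_block_mat A (A * T) (0\<^sub>m l k) B"
    and "four_block_mat (1\<^sub>m k) T (0\<^sub>m l k) (1\<^sub>m l) * dsum_mat A B = four_block_mat A (T * B) (0\<^sub>m l k) B"
  using assms by (simp_all add: dsum_mat_def mult_four_block_mat[where ?nr1.0 = k and ?nr2.0 = l and ?n1.0 = k and ?n2.0 = l and ?nc1.0 = k and ?nc2.0 = l])

text \<open>The matrix \<open>[[1, T], [0, 1]]\<close> commutes with the direct sum of \<open>X\<close> and \<open>X'\<close> precisely when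
  \<open>X T = T X'\<close>, so invariance of \<open>f\<close> under this one similarity transfers the relation to the values of \<open>f\<close>.\<close>

lemma nc_function_intertwining:
  assumes f: "nc_function d \<Omega> f" and X: "X \<in> \<Omega>" "X' \<in> \<Omega>" and d: "0 < d"
    and T: "T \<in> carrier_mat (level X) (level X')"
    and XT: "\<And>i. i < d \<Longrightarrow> X ! i * T = T * X' ! i"
  shows "f X * T = T * f X'"
proof -
  have sub: "\<Omega> \<subseteq> ncpts d" using f by (simp add: nc_function_def)
  obtain k where k: "0 < k" "length X = d" "level X = k" "X \<noteq> []" "\<forall>M\<in>set X. M \<in> carrier_mat k k"
    using ncptsE X sub d by blast
  obtain l where l: "0 < l" "length X' = d" "level X' = l" "X' \<noteq> []" "\<forall>M\<in>set X'. M \<in> carrier_mat l l"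
    using ncptsE X sub d by blast
  have T: "T \<in> carrier_mat k l" using T k l by simp
  define S where "S = four_block_mat (1\<^sub>m k) T (0\<^sub>m l k) (1\<^sub>m l)"
  define S' where "S' = four_block_mat (1\<^sub>m k) (- T) (0\<^sub>m l k) (1\<^sub>m l)"
  have SS: "S \<in> carrier_mat (k + l) (k + l)" "S' \<in> carrier_mat (k + l) (k + l)"
    by (auto simp: S_def S'_def)
  have TmT: "T + - T = 0\<^sub>m k l" "- T + T = 0\<^sub>m k l" "- 0\<^sub>m l l + 1\<^sub>m l = (1\<^sub>m l :: complex mat)"
    using T by (auto intro!: eq_matI)
  have inv: "S * S' = 1\<^sub>m (k + l)" "S' * S = 1\<^sub>m (k + l)"
    using T TmT unfolding S_def S'_def
    by (simp_all add: mult_four_block_mat[where ?nr1.0 = k and ?nr2.0 = l and ?n1.0 = k and ?n2.0 = l and ?nc1.0 = k and ?nc2.0 = l])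
  define D where "D = dsum X X'"
  have D: "D \<in> \<Omega>" using f X by (simp add: nc_function_def D_def)
  have lenD: "length D = d" using k l by (simp add: D_def dsum_def)
  have Di: "D ! i = dsum_mat (X ! i) (X' ! i)" if "i < d" for i
    using that k l by (simp add: D_def dsum_def)
  have carr: "X ! i \<in> carrier_mat k k" "X' ! i \<in> carrier_mat l l" "D ! i \<in> carrier_mat (k + l) (k + l)" if "i < d" for i
    using that k l Di dsum_mat_carrier by auto
  have lev: "level D = k + l"
    using carr(3)[of 0] d lenD by (cases D) (auto simp: level_def)
  \<comment> \<open>Conjugation by \<open>S\<close> fixes \<open>D\<close>, so the conjugated point
    lies in \<open>\<Omega>\<close>, as the similarity axiom asks.\<close>
  have "map (\<lambda>M. S' * M * S) D = D"
  proof (rule nth_equalityI)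
    fix i assume "i < length (map (\<lambda>M. S' * M * S) D)"
    hence i: "i < d" using lenD by simp
    have "D ! i * S = S * D ! i"
      using dsum_mat_mult_unipotent[OF carr(1,2)[OF i] T] XT[OF i] Di[OF i] by (simp add: S_def)
    hence "S' * D ! i * S = S' * (S * D ! i)" using carr(3)[OF i] SS by simp
    also have "\<dots> = D ! i" using carr(3)[OF i] SS inv by (simp flip: assoc_mult_mat[of S'])
    finally show "map (\<lambda>M. S' * M * S) D ! i = D ! i" using i lenD by simp
  qed simp
  moreover note f[unfolded nc_function_def, THEN conjunct2, THEN conjunct2, THEN conjunct2, THEN conjunct2,
      rule_format, OF D, unfolded lev, of S S']
  ultimately have fD: "f D = S' * f D * S" using D SS inv by simp
  have c: "f X \<in> carrier_mat k k" "f X' \<in> carrier_mat l l" "f D \<in> carrier_mat (k + l) (k + l)"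
    using f X D k l lev by (auto simp: nc_function_def)
  have "S * f D = S * (S' * (f D * S))" using fD c SS by simp
  also have "\<dots> = f D * S" using assoc_mult_mat[OF SS, of "f D * S" "k + l"] c SS inv by simp
  finally have "S * f D = f D * S" .
  moreover have "f D = dsum_mat (f X) (f X')" using f X by (simp add: nc_function_def D_def)
  ultimately have eq: "four_block_mat (f X) (T * f X') (0\<^sub>m l k) (f X') = four_block_mat (f X) (f X * T) (0\<^sub>m l k) (f X')"
    using dsum_mat_mult_unipotent[OF c(1,2) T] by (simp add: S_def)
  show ?thesis
  proof (rule eq_matI)
    fix i j assume "i < dim_row (T * f X')" "j < dim_col (T * f X')"
    hence ij: "i < k" "j < l" using T c by auto
    have "four_block_mat (f X) (T * f X') (0\<^sub>m l k) (f X') $$ (i, k + j) = four_block_mat (f X) (f X * T) (0\<^sub>m l k) (f X') $$ (i, k + j)"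
      using eq by simp
    thus "(f X * T) $$ (i, j) = (T * f X') $$ (i, j)"
      using ij c T by (simp del: index_mult_mat(1))
  qed (use T c in auto)
qed

section \<open>Points near the centre in block coordinates\<close>

text \<open>Tuples are coded by functions: \<open>W j p q a b\<close> is the \<open>(p, q)\<close> entry of the \<open>(a, b)\<close> block of the \<open>j\<close>-th matrix.\<close>

definition wmat :: "nat \<Rightarrow> nat \<Rightarrow> (nat \<Rightarrow> nat \<Rightarrow> nat \<Rightarrow> nat \<Rightarrow> nat \<Rightarrow> complex) \<Rightarrow> nat \<Rightarrow> complex mat" where
  "wmat n A W j = mat (A * n) (A * n) (\<lambda>(x, y). W j (x mod n) (y mod n) (x div n) (y div n))"

definition tup :: "nat \<Rightarrow> nat \<Rightarrow> complex mat list \<Rightarrow> nat \<Rightarrow> (nat \<Rightarrow> nat \<Rightarrow> nat \<Rightarrow> nat \<Rightarrow> nat \<Rightarrow> complex) \<Rightarrow> complex mat list" where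
  "tup d n Y A W = map (\<lambda>j. ampl A (Y ! j) + wmat n A W j) [0..<d]"

text \<open>\<open>colbd\<close> for the tuple of the \<open>wmat n A W j\<close>, written out in
  coordinates \<open>u b q\<close>, so that operators indexed by tree nodes can be bounded by
  reordering sums.\<close>

definition wbound :: "nat \<Rightarrow> nat \<Rightarrow> nat \<Rightarrow> (nat \<Rightarrow> nat \<Rightarrow> nat \<Rightarrow> nat \<Rightarrow> nat \<Rightarrow> complex) \<Rightarrow> real \<Rightarrow> bool" where
  "wbound d n A W r \<longleftrightarrow> (\<forall>u :: nat \<Rightarrow> nat \<Rightarrow> complex.
     (\<Sum>j<d. \<Sum>a<A. \<Sum>p<n. (cmod (\<Sum>b<A. \<Sum>q<n. W j p q a b * u b q))\<^sup>2)
       \<le> r\<^sup>2 * (\<Sum>b<A. \<Sum>q<n. (cmod (u b q))\<^sup>2))"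

lemma wmat_carrier [simp]: "wmat n A W j \<in> carrier_mat (A * n) (A * n)"
  by (simp add: wmat_def)

lemma wmat_index: "a < A \<Longrightarrow> b < A \<Longrightarrow> p < n \<Longrightarrow> q < n \<Longrightarrow> wmat n A W j $$ (a * n + p, b * n + q) = W j p q a b"
  by (simp add: wmat_def mult_add_less)

lemma cvnorm_mult_blocks:
  assumes "M \<in> carrier_mat (A * n) (A * n)" "v \<in> carrier_vec (A * n)"
  shows "(cvnorm (M *\<^sub>v v))\<^sup>2 = (\<Sum>a<A. \<Sum>p<n. (cmod (\<Sum>b<A. \<Sum>q<n. M $$ (a * n + p, b * n + q) * v $ (b * n + q)))\<^sup>2)"
proof -
  have "(cvnorm (M *\<^sub>v v))\<^sup>2 = (\<Sum>x<A * n. (cmod (\<Sum>y<A * n. M $$ (x, y) * v $ y))\<^sup>2)"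
    using assms by (simp add: cvnorm_sq scalar_prod_def lessThan_atLeast0)
  thus ?thesis by (simp add: sum_lessThan_mult)
qed

lemma colbd_blocks:
  assumes "\<forall>M\<in>set X. M \<in> carrier_mat (A * n) (A * n)" "X \<noteq> []" "colbd X r"
  shows "(\<Sum>j<length X. \<Sum>a<A. \<Sum>p<n. (cmod (\<Sum>b<A. \<Sum>q<n. (X ! j) $$ (a * n + p, b * n + q) * u b q))\<^sup>2)
       \<le> r\<^sup>2 * (\<Sum>b<A. \<Sum>q<n. (cmod (u b q))\<^sup>2)"
proof -
  define v where "v = vec (A * n) (\<lambda>x. u (x div n) (x mod n))"
  have v: "v \<in> carrier_vec (A * n)" by (simp add: v_def)
  have vi: "v $ (b * n + q) = u b q" if "b < A" "q < n" for b q
    using that by (simp add: v_def mult_add_less)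
  have "dim_col (hd X) = A * n" using assms(1,2) by (cases X) auto
  hence "(\<Sum>M\<leftarrow>X. (cvnorm (M *\<^sub>v v))\<^sup>2) \<le> r\<^sup>2 * (cvnorm v)\<^sup>2"
    using assms(3) v by (simp add: colbd_def)
  also have "(\<Sum>M\<leftarrow>X. (cvnorm (M *\<^sub>v v))\<^sup>2) = (\<Sum>j<length X. (cvnorm ((X ! j) *\<^sub>v v))\<^sup>2)"
    by (simp add: sum_list_sum_nth lessThan_atLeast0)
  also have "\<dots> = (\<Sum>j<length X. \<Sum>a<A. \<Sum>p<n. (cmod (\<Sum>b<A. \<Sum>q<n. (X ! j) $$ (a * n + p, b * n + q) * u b q))\<^sup>2)"
    using assms(1) v by (intro sum.cong refl) (simp add: cvnorm_mult_blocks[where A = A and n = n] vi cong: sum.cong_simp)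
  also have "(cvnorm v)\<^sup>2 = (\<Sum>b<A. \<Sum>q<n. (cmod (u b q))\<^sup>2)"
    by (simp add: cvnorm_sq v_def sum_lessThan_mult mult_add_less)
  finally show ?thesis .
qed

lemma colbd_wmat:
  assumes d: "0 < d" and W: "wbound d n A W r"
  shows "colbd (map (wmat n A W) [0..<d]) r"
  unfolding colbd_def
proof
  have "dim_col (hd (map (wmat n A W) [0..<d])) = A * n" using d by (simp add: hd_map wmat_def)
  moreover fix v :: "complex vec" assume "v \<in> carrier_vec (dim_col (hd (map (wmat n A W) [0..<d])))"
  ultimately have v: "v \<in> carrier_vec (A * n)" by simp
  have "(\<Sum>M\<leftarrow>map (wmat n A W) [0..<d]. (cvnorm (M *\<^sub>v v))\<^sup>2) = (\<Sum>j<d. (cvnorm (wmat n A W j *\<^sub>v v))\<^sup>2)"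
    by (simp add: sum_list_sum_nth lessThan_atLeast0)
  also have "\<dots> = (\<Sum>j<d. \<Sum>a<A. \<Sum>p<n. (cmod (\<Sum>b<A. \<Sum>q<n. W j p q a b * v $ (b * n + q)))\<^sup>2)"
    using v by (intro sum.cong refl) (simp add: cvnorm_mult_blocks[where A = A and n = n] wmat_index cong: sum.cong_simp)
  also have "\<dots> \<le> r\<^sup>2 * (\<Sum>b<A. \<Sum>q<n. (cmod (v $ (b * n + q)))\<^sup>2)"
    using spec[OF W[unfolded wbound_def], of "\<lambda>b q. v $ (b * n + q)"] .
  also have "\<dots> = r\<^sup>2 * (cvnorm v)\<^sup>2"
    using v by (simp add: cvnorm_sq sum_lessThan_mult)
  finally show "(\<Sum>M\<leftarrow>map (wmat n A W) [0..<d]. (cvnorm (M *\<^sub>v v))\<^sup>2) \<le> r\<^sup>2 * (cvnorm v)\<^sup>2" .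
qed

lemma level_tup:
  assumes "0 < d" "length Y = d" "\<forall>M\<in>set Y. M \<in> carrier_mat n n"
  shows "level (tup d n Y A W) = A * n"
  using assms by (simp add: level_def tup_def hd_map wmat_def)

lemma tup_nth:
  assumes "length Y = d" "\<forall>M\<in>set Y. M \<in> carrier_mat n n" "j < d"
  shows "tup d n Y A W ! j \<in> carrier_mat (A * n) (A * n)"
    and "\<lbrakk>a < A; b < A; p < n; q < n\<rbrakk> \<Longrightarrow>
      (tup d n Y A W ! j) $$ (a * n + p, b * n + q) = (if a = b then (Y ! j) $$ (p, q) else 0) + W j p q a b"
proof -
  have "Y ! j \<in> carrier_mat n n" using assms by simp
  thus "tup d n Y A W ! j \<in> carrier_mat (A * n) (A * n)"
    and "\<lbrakk>a < A; b < A; p < n; q < n\<rbrakk> \<Longrightarrow>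
      (tup d n Y A W ! j) $$ (a * n + p, b * n + q) = (if a = b then (Y ! j) $$ (p, q) else 0) + W j p q a b"
    using assms(3) by (auto simp: tup_def wmat_def ampl_def Let_def mult_add_less)
qed

text \<open>The supremum only inherits the weak bound by \<open>s\<close>; the gap
  \<open>s < r\<close> supplies the strict inequality that membership demands.\<close>

lemma tup_in_ubasic:
  assumes d: "0 < d" and n: "0 < n" and Y: "length Y = d" "\<forall>M\<in>set Y. M \<in> carrier_mat n n"
    and A: "0 < A" and W: "wbound d n A W s" and s: "0 \<le> s" "s < r"
  shows "tup d n Y A W \<in> ubasic d Y r"
proof -
  have "tup d n Y A W \<in> ncpts d"
    using A n d Y by (auto simp: ncpts_def in_set_conv_nth tup_nth intro!: exI[of _ "A * n"]) (auto simp: tup_def wmat_def)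
  moreover have "level Y = n" using Y d by (cases Y) (auto simp: level_def)
  moreover have "tsub (tup d n Y A W) (map (ampl A) Y) = map (wmat n A W) [0..<d]"
  proof (rule nth_equalityI)
    fix j assume "j < length (tsub (tup d n Y A W) (map (ampl A) Y))"
    hence j: "j < d" by (simp add: tsub_def tup_def)
    hence "Y ! j \<in> carrier_mat n n" using Y by simp
    thus "tsub (tup d n Y A W) (map (ampl A) Y) ! j = map (wmat n A W) [0..<d] ! j"
      using j by (auto intro!: eq_matI simp: Y(1) tsub_def tup_def wmat_def ampl_def Let_def)
  qed (use Y in \<open>simp add: tsub_def tup_def\<close>)
  moreover have "colnorm (map (wmat n A W) [0..<d]) \<le> s"
    using d n A by (intro colnorm_le colbd_wmat W s) (simp add: hd_map wmat_def)
  ultimately show ?thesis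
    using level_tup[OF d Y, of A W] s unfolding ubasic_def by fastforce
qed

lemma ubasic_tupE:
  assumes d: "0 < d" and n: "0 < n" and Y: "length Y = d" "\<forall>M\<in>set Y. M \<in> carrier_mat n n"
    and X: "X \<in> ubasic d Y r"
  obtains m W where "0 < m" "level X = m * n" "X = tup d n Y m W"
    "tsub X (map (ampl m) Y) = map (wmat n m W) [0..<d]" "wbound d n m W r"
proof -
  have lY: "level Y = n" using Y d by (cases Y) (auto simp: level_def)
  from X obtain m where m: "level X = m * n" and lt: "colnorm (tsub X (map (ampl m) Y)) < r" and Xn: "X \<in> ncpts d"
    by (auto simp: ubasic_def lY)
  from Xn d obtain k where k: "0 < k" "length X = d" "level X = k" "X \<noteq> []" "\<forall>M\<in>set X. M \<in> carrier_mat k k"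
    by (rule ncptsE)
  have km: "k = m * n" using k m by simp
  define Z where "Z = tsub X (map (ampl m) Y)"
  define W where "W j p q s t = (Z ! j) $$ (s * n + p, t * n + q)" for j p q s t
  have Z: "\<forall>M\<in>set Z. M \<in> carrier_mat (m * n) (m * n)" "Z \<noteq> []" "length Z = d"
    using tsub_carrier[of "map (ampl m) Y" "m * n" X] Y ampl_carrier k d by (auto simp: Z_def tsub_def)
  have mn: "0 < m * n" using k km by simp
  have "colbd Z r" "0 \<le> r"
    using colbd_colnorm[OF Z(1,2) mn] lt colbd_mono[of Z "colnorm Z" r] by (auto simp: Z_def)
  hence wb: "wbound d n m W r"
    using colbd_blocks[OF Z(1,2), of r] Z(3) unfolding wbound_def W_def by blast
  have Zw: "Z = map (wmat n m W) [0..<d]"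
  proof (rule nth_equalityI)
    fix j assume "j < length Z"
    hence j: "j < d" "Z ! j \<in> carrier_mat (m * n) (m * n)" using Z by auto
    show "Z ! j = map (wmat n m W) [0..<d] ! j"
      using j by (auto intro!: eq_matI simp: wmat_def W_def)
  qed (use Z in auto)
  have "X = tup d n Y m W"
  proof (rule nth_equalityI)
    fix j assume "j < length X"
    hence j: "j < d" "X ! j \<in> carrier_mat (m * n) (m * n)" "Y ! j \<in> carrier_mat n n" using k km Y by auto
    have "wmat n m W j = Z ! j" using Zw j by simp
    also have "\<dots> = X ! j - ampl m (Y ! j)" using j k Y by (simp add: Z_def tsub_def)
    finally show "X ! j = tup d n Y m W ! j"
      using j ampl_carrier[OF j(3), of m] by (auto intro!: eq_matI simp: tup_def)
  qed (use k in \<open>simp add: tup_def\<close>)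
  thus ?thesis using that[of m W] mn m Zw wb by (auto simp: Z_def)
qed

text \<open>The centre drops out: in both products it contributes
  \<open>(Y ! j) $$ (p, q) * T a b\<close>, since \<open>TT\<close> below is \<open>T\<close>
  tensored with the identity of size \<open>n\<close>. Only the perturbations have to be
  intertwined, letter by letter.\<close>

lemma tup_intertwining:
  fixes W W' T
  assumes f: "nc_function d \<Omega> f" and d: "0 < d"
    and Y: "length Y = d" "\<forall>M\<in>set Y. M \<in> carrier_mat n n"
    and X: "tup d n Y A W \<in> \<Omega>" "tup d n Y A' W' \<in> \<Omega>"
    and T: "\<And>j p q a b. \<lbrakk>j < d; p < n; q < n; a < A; b < A'\<rbrakk> \<Longrightarrow>
        (\<Sum>c<A. W j p q a c * T c b) = (\<Sum>c<A'. T a c * W' j p q c b)"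
    and b: "a < A" "b < A'" "p < n" "q < n"
  shows "(\<Sum>c<A. f (tup d n Y A W) $$ (a * n + p, c * n + q) * T c b)
       = (\<Sum>c<A'. T a c * f (tup d n Y A' W') $$ (c * n + p, b * n + q))"
proof -
  define TT where "TT = mat (A * n) (A' * n) (\<lambda>(x, y). if x mod n = y mod n then T (x div n) (y div n) else 0)"
  have TT: "TT \<in> carrier_mat (A * n) (A' * n)" by (simp add: TT_def)
  have TTi: "TT $$ (a * n + p, b * n + q) = (if p = q then T a b else 0)" if "a < A" "b < A'" "p < n" "q < n" for a b p q
    using that by (simp add: TT_def mult_add_less)
  have right: "(M * TT) $$ (a * n + p, b * n + q) = (\<Sum>c<A. M $$ (a * n + p, c * n + q) * T c b)"
    if "M \<in> carrier_mat (A * n) (A * n)" "a < A" "b < A'" "p < n" "q < n" for M a b p q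
  proof -
    have "(M * TT) $$ (a * n + p, b * n + q) = (\<Sum>x<A * n. M $$ (a * n + p, x) * TT $$ (x, b * n + q))"
      using that TT by (simp add: scalar_prod_def mult_add_less lessThan_atLeast0)
    also have "\<dots> = (\<Sum>c<A. \<Sum>s<n. if s = q then M $$ (a * n + p, c * n + q) * T c b else 0)"
      unfolding sum_lessThan_mult using that by (intro sum.cong refl) (auto simp: TTi)
    also have "\<dots> = (\<Sum>c<A. M $$ (a * n + p, c * n + q) * T c b)"
      using that by simp
    finally show ?thesis .
  qed
  have left: "(TT * M) $$ (a * n + p, b * n + q) = (\<Sum>c<A'. T a c * M $$ (c * n + p, b * n + q))"
    if "M \<in> carrier_mat (A' * n) (A' * n)" "a < A" "b < A'" "p < n" "q < n" for M a b p q
  proof -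
    have "(TT * M) $$ (a * n + p, b * n + q) = (\<Sum>x<A' * n. TT $$ (a * n + p, x) * M $$ (x, b * n + q))"
      using that TT by (simp add: scalar_prod_def mult_add_less lessThan_atLeast0)
    also have "\<dots> = (\<Sum>c<A'. \<Sum>s<n. if s = p then T a c * M $$ (c * n + p, b * n + q) else 0)"
      unfolding sum_lessThan_mult using that by (intro sum.cong refl) (auto simp: TTi)
    also have "\<dots> = (\<Sum>c<A'. T a c * M $$ (c * n + p, b * n + q))"
      using that by simp
    finally show ?thesis .
  qed
  note lev = level_tup[OF d Y]
  have "f (tup d n Y A W) * TT = TT * f (tup d n Y A' W')"
  proof (rule nc_function_intertwining[OF f X d])
    show "TT \<in> carrier_mat (level (tup d n Y A W)) (level (tup d n Y A' W'))"
      using TT by (simp add: lev)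
  next
    fix j assume j: "j < d"
    note c = tup_nth(1)[OF Y j] and ci = tup_nth(2)[OF Y j]
    show "tup d n Y A W ! j * TT = TT * tup d n Y A' W' ! j"
    proof (rule eq_matI)
      fix x y assume xy: "x < dim_row (TT * tup d n Y A' W' ! j)" "y < dim_col (TT * tup d n Y A' W' ! j)"
      hence xy: "x < A * n" "y < A' * n" using TT c[of A' W'] by auto
      define a p b q where "a = x div n" "p = x mod n" "b = y div n" "q = y mod n"
      have n: "0 < n" using xy by (cases n) auto
      have ab: "a < A" "b < A'" "p < n" "q < n"
        using xy n by (auto simp: a_p_b_q_def less_mult_imp_div_less)
      have x: "x = a * n + p" "y = b * n + q" by (auto simp: a_p_b_q_def)
      have "(tup d n Y A W ! j * TT) $$ (x, y) = (\<Sum>c<A. (if a = c then (Y ! j) $$ (p, q) * T a b else 0) + W j p q a c * T c b)"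
        unfolding x right[OF c ab] using ab by (intro sum.cong refl) (auto simp: ci distrib_right)
      also have "\<dots> = (Y ! j) $$ (p, q) * T a b + (\<Sum>c<A. W j p q a c * T c b)"
        using ab by (simp add: sum.distrib)
      also have "\<dots> = (Y ! j) $$ (p, q) * T a b + (\<Sum>c<A'. T a c * W' j p q c b)"
        using T[OF j ab(3,4,1,2)] by simp
      also have "\<dots> = (\<Sum>c<A'. (if c = b then (Y ! j) $$ (p, q) * T a b else 0) + T a c * W' j p q c b)"
        using ab by (simp add: sum.distrib)
      also have "\<dots> = (TT * tup d n Y A' W' ! j) $$ (x, y)"
        unfolding x left[OF c ab] using ab by (intro sum.cong refl) (auto simp: ci distrib_left)
      finally show "(tup d n Y A W ! j * TT) $$ (x, y) = (TT * tup d n Y A' W' ! j) $$ (x, y)" .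
    qed (use TT c[of A W] c[of A' W'] in auto)
  qed
  moreover have "f (tup d n Y A W) \<in> carrier_mat (A * n) (A * n)" "f (tup d n Y A' W') \<in> carrier_mat (A' * n) (A' * n)"
    using f X lev[of A W] lev[of A' W'] unfolding nc_function_def by metis+
  ultimately show ?thesis
    using right[of "f (tup d n Y A W)", OF _ b] left[of "f (tup d n Y A' W')", OF _ b] by simp
qed

section \<open>Word coding and the pencil\<close>

lemma sum_lessThan_add:
  fixes g :: "nat \<Rightarrow> 'a::comm_monoid_add"
  shows "sum g {..<a + b} = (\<Sum>i<a. g i) + (\<Sum>i<b. g (a + i))"
  by (induction b) (simp_all add: add.assoc)

lemma l2_iff_bounded: "x \<in> l2 \<longleftrightarrow> (\<exists>C. \<forall>K. (\<Sum>i<K. (cmod (x i))\<^sup>2) \<le> C)"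
proof
  assume "x \<in> l2"
  hence "\<forall>K. (\<Sum>i<K. (cmod (x i))\<^sup>2) \<le> (\<Sum>i. (cmod (x i))\<^sup>2)"
    by (auto simp: l2_def intro: sum_le_suminf)
  thus "\<exists>C. \<forall>K. (\<Sum>i<K. (cmod (x i))\<^sup>2) \<le> C" by blast
next
  assume "\<exists>C. \<forall>K. (\<Sum>i<K. (cmod (x i))\<^sup>2) \<le> C"
  thus "x \<in> l2" unfolding l2_def by (auto intro!: summableI_nonneg_bounded)
qed

lemma cmod_add_sq_le: "(cmod (x + y))\<^sup>2 \<le> 2 * (cmod x)\<^sup>2 + 2 * (cmod y)\<^sup>2"
proof -
  have "(cmod (x + y))\<^sup>2 \<le> (cmod x + cmod y)\<^sup>2" by (intro power_mono norm_triangle_ineq) simp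
  also have "\<dots> \<le> 2 * (cmod x)\<^sup>2 + 2 * (cmod y)\<^sup>2"
    using sum_squares_bound[of "cmod x" "cmod y"] by (simp add: power2_sum)
  finally show ?thesis .
qed

lemma l2_add: "x \<in> l2 \<Longrightarrow> y \<in> l2 \<Longrightarrow> (\<lambda>i. x i + y i) \<in> l2"
  unfolding l2_def mem_Collect_eq
  by (rule summable_comparison_test'[where N = 0 and g = "\<lambda>i. 2 * (cmod (x i))\<^sup>2 + 2 * (cmod (y i))\<^sup>2"])
     (auto intro!: summable_add summable_mult cmod_add_sq_le)

lemma l2_diff: "x \<in> l2 \<Longrightarrow> y \<in> l2 \<Longrightarrow> (\<lambda>i. x i - y i) \<in> l2"
  using l2_add[of x "\<lambda>i. - y i"] by (simp add: l2_def)

text \<open>Naturals code the nodes of \<open>n\<close> disjoint trees of branching \<open>d n\<^sup>2\<close>, i.e. pairs of a word over the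
  letters \<open>(j, p, q)\<close> (with \<open>j < d\<close> and \<open>p, q < n\<close>) and a root \<open>l < n\<close>: the roots are the numbers
  below \<open>n\<close>, and every \<open>i \<ge> n\<close> is \<open>child j p q i'\<close> for unique \<open>j\<close>, \<open>p\<close>, \<open>q\<close>, \<open>i'\<close>.\<close>

locale node_coding =
  fixes d n :: nat
  assumes d_pos: "0 < d" and n_pos: "0 < n"
begin

definition child :: "nat \<Rightarrow> nat \<Rightarrow> nat \<Rightarrow> nat \<Rightarrow> nat" where
  "child j p q i = n + (((i * d + j) * n + p) * n + q)"

definition lq :: "nat \<Rightarrow> nat" where "lq i = (i - n) mod n"
definition lp :: "nat \<Rightarrow> nat" where "lp i = (i - n) div n mod n"
definition lj :: "nat \<Rightarrow> nat" where "lj i = (i - n) div n div n mod d"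
definition par :: "nat \<Rightarrow> nat" where "par i = (i - n) div n div n div d"

lemma decode_child [simp]:
  assumes "j < d" "p < n" "q < n"
  shows "lq (child j p q i) = q" "lp (child j p q i) = p" "lj (child j p q i) = j" "par (child j p q i) = i"
  using assms by (simp_all add: child_def lq_def lp_def lj_def par_def)

lemma letters_less [simp]: "lq i < n" "lp i < n" "lj i < d"
  using d_pos n_pos by (simp_all add: lq_def lp_def lj_def)

lemma child_decode: "n \<le> i \<Longrightarrow> child (lj i) (lp i) (lq i) (par i) = i"
  by (simp add: child_def lq_def lp_def lj_def par_def)

lemma child_ge [simp]: "n \<le> child j p q i"
  by (simp add: child_def)

lemma child_not_root [simp]: "\<not> child j p q i < n"
  by (simp add: child_def)

lemma child_eq_iff:
  assumes "j < d" "p < n" "q < n"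
  shows "a = child j p q b \<longleftrightarrow> n \<le> a \<and> j = lj a \<and> p = lp a \<and> q = lq a \<and> b = par a"
  using assms child_decode by auto

text \<open>That codes grow from parent to child gives termination of \<open>solution\<close>,
  injectivity of the pencil, and the triangular form behind truncation to an initial
  segment.\<close>

lemma par_less: "n \<le> i \<Longrightarrow> par i < i"
proof -
  assume "n \<le> i"
  moreover have "par i \<le> i - n" unfolding par_def by (meson div_le_dividend le_trans)
  ultimately show ?thesis using n_pos by linarith
qed

lemma less_child: "j < d \<Longrightarrow> p < n \<Longrightarrow> q < n \<Longrightarrow> i < child j p q i"
  using par_less[of "child j p q i"] by simp

lemma sum_children:
  fixes g :: "nat \<Rightarrow> 'a::comm_monoid_add"
  shows "(\<Sum>i<n + K * d * n * n. if i < n then 0 else g i) = (\<Sum>b<K. \<Sum>j<d. \<Sum>p<n. \<Sum>q<n. g (child j p q b))"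
  by (simp add: sum_lessThan_add sum_lessThan_mult child_def)

text \<open>The children of the first \<open>K\<close> nodes fill exactly an interval that starts at
  \<open>n\<close> and reaches at least to \<open>K\<close>.\<close>

lemma sum_children_le:
  fixes g :: "nat \<Rightarrow> real"
  assumes "\<And>i. 0 \<le> g i"
  shows "(\<Sum>i<K. if i < n then 0 else g i) \<le> (\<Sum>b<K. \<Sum>j<d. \<Sum>p<n. \<Sum>q<n. g (child j p q b))"
proof -
  have "K \<le> n + K * d * n * n" using d_pos n_pos by (simp add: trans_le_add2)
  hence "(\<Sum>i<K. if i < n then 0 else g i) \<le> (\<Sum>i<n + K * d * n * n. if i < n then 0 else g i)"
    using assms by (intro sum_mono2) auto
  thus ?thesis unfolding sum_children .
qed

section \<open>Creation operators and their norms\<close>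

definition shift :: "real \<Rightarrow> nat \<Rightarrow> nat \<Rightarrow> nat \<Rightarrow> nat \<Rightarrow> nat \<Rightarrow> complex" where
  "shift \<rho> j p q a b = (if a = child j p q b then of_real \<rho> else 0)"

text \<open>Row \<open>a\<close> is nonzero only for the letter indices \<open>j\<close>,
  \<open>p\<close> of \<open>a\<close> itself, and then it picks out
  \<open>u (par a) (lq a)\<close>. A given \<open>u b q\<close> is picked by at most
  \<open>d * n\<close> nodes, one for each pair \<open>(j, p)\<close>.\<close>

lemma shift_bound:
  "(\<Sum>j<d. \<Sum>a<I. \<Sum>p<n. (cmod (\<Sum>b<I. \<Sum>q<n. shift \<rho> j p q a b * u b q))\<^sup>2)
     \<le> \<rho>\<^sup>2 * (d * n) * (\<Sum>b<I. \<Sum>q<n. (cmod (u b q))\<^sup>2)"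
proof -
  have inner: "(\<Sum>b<I. \<Sum>q<n. shift \<rho> j p q a b * u b q)
      = (if p = lp a then if j = lj a then if n \<le> a then \<rho> * u (par a) (lq a) else 0 else 0 else 0)"
    if "j < d" "p < n" "a < I" for j p a
  proof -
    define X where "X = (if p = lp a then if j = lj a then if n \<le> a then \<rho> * u (par a) (lq a) else 0 else 0 else 0)"
    have "(\<Sum>b<I. \<Sum>q<n. shift \<rho> j p q a b * u b q) = (\<Sum>b<I. \<Sum>q<n. if q = lq a then if b = par a then X else 0 else 0)"
      using that by (intro sum.cong refl) (auto simp: shift_def child_eq_iff X_def)
    also have "\<dots> = (\<Sum>b<I. if b = par a then X else 0)" by simp
    also have "\<dots> = X" using that par_less[of a] by (auto simp: X_def)
    finally show ?thesis by (simp only: X_def)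
  qed
  have "(\<Sum>j<d. \<Sum>a<I. \<Sum>p<n. (cmod (\<Sum>b<I. \<Sum>q<n. shift \<rho> j p q a b * u b q))\<^sup>2)
      = (\<Sum>j<d. \<Sum>a<I. \<Sum>p<n. if p = lp a then if j = lj a then if a < n then 0 else \<rho>\<^sup>2 * (cmod (u (par a) (lq a)))\<^sup>2 else 0 else 0)"
    by (intro sum.cong refl) (simp add: inner norm_mult power_mult_distrib)
  also have "\<dots> = (\<Sum>j<d. \<Sum>a<I. if j = lj a then if a < n then 0 else \<rho>\<^sup>2 * (cmod (u (par a) (lq a)))\<^sup>2 else 0)"
    by simp
  also have "\<dots> = (\<Sum>a<I. if a < n then 0 else \<rho>\<^sup>2 * (cmod (u (par a) (lq a)))\<^sup>2)"
    by (subst sum.swap) simp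
  also have "\<dots> \<le> (\<Sum>b<I. \<Sum>j<d. \<Sum>p<n. \<Sum>q<n. \<rho>\<^sup>2 * (cmod (u (par (child j p q b)) (lq (child j p q b))))\<^sup>2)"
    by (rule sum_children_le) simp
  also have "\<dots> = (\<Sum>b<I. \<Sum>j<d. \<Sum>p<n. \<Sum>q<n. \<rho>\<^sup>2 * (cmod (u b q))\<^sup>2)"
    by (intro sum.cong refl) simp
  also have "\<dots> = \<rho>\<^sup>2 * (d * n) * (\<Sum>b<I. \<Sum>q<n. (cmod (u b q))\<^sup>2)"
    by (simp add: sum_distrib_left mult_ac)
  finally show ?thesis .
qed

text \<open>The sum over \<open>p\<close>, \<open>q\<close> of \<open>\<alpha> * M $$ (p, q)\<close>
  times the creation operator of the letter \<open>(j, p, q)\<close>, written as what each node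
  receives from its parent.\<close>

definition coeff_op :: "real \<Rightarrow> nat \<Rightarrow> complex mat \<Rightarrow> (nat \<Rightarrow> complex) \<Rightarrow> nat \<Rightarrow> complex" where
  "coeff_op \<alpha> j M x i = (if i < n then 0 else if lj i = j then of_real \<alpha> * M $$ (lp i, lq i) * x (par i) else 0)"

text \<open>Different letters create orthogonal ranges, so squares add and the Frobenius norm of
  \<open>M\<close> appears. The estimate closes on initial segments because a non-root below
  \<open>K\<close> has its parent below \<open>K\<close>.\<close>

lemma coeff_op_bound:
  assumes j: "j < d"
  shows "(\<Sum>i<K. (cmod (coeff_op \<alpha> j M x i))\<^sup>2) \<le> \<alpha>\<^sup>2 * (\<Sum>p<n. \<Sum>q<n. (cmod (M $$ (p, q)))\<^sup>2) * (\<Sum>i<K. (cmod (x i))\<^sup>2)"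
proof -
  have "(\<Sum>i<K. (cmod (coeff_op \<alpha> j M x i))\<^sup>2)
      = (\<Sum>i<K. if i < n then 0 else if lj i = j then \<alpha>\<^sup>2 * (cmod (M $$ (lp i, lq i)))\<^sup>2 * (cmod (x (par i)))\<^sup>2 else 0)"
    by (intro sum.cong refl) (simp add: coeff_op_def norm_mult power_mult_distrib)
  also have "\<dots> \<le> (\<Sum>b<K. \<Sum>j'<d. \<Sum>p<n. \<Sum>q<n. if lj (child j' p q b) = j then \<alpha>\<^sup>2 * (cmod (M $$ (lp (child j' p q b), lq (child j' p q b))))\<^sup>2 * (cmod (x (par (child j' p q b))))\<^sup>2 else 0)"
    by (rule sum_children_le) simp
  also have "\<dots> = (\<Sum>b<K. \<Sum>j'<d. if j' = j then \<Sum>p<n. \<Sum>q<n. \<alpha>\<^sup>2 * (cmod (M $$ (p, q)))\<^sup>2 * (cmod (x b))\<^sup>2 else 0)"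
    by (intro sum.cong refl) auto
  also have "\<dots> = (\<Sum>b<K. \<alpha>\<^sup>2 * (\<Sum>p<n. \<Sum>q<n. (cmod (M $$ (p, q)))\<^sup>2) * (cmod (x b))\<^sup>2)"
    using j by (simp add: sum_distrib_left sum_distrib_right)
  also have "\<dots> = \<alpha>\<^sup>2 * (\<Sum>p<n. \<Sum>q<n. (cmod (M $$ (p, q)))\<^sup>2) * (\<Sum>i<K. (cmod (x i))\<^sup>2)"
    by (simp add: sum_distrib_left)
  finally show ?thesis .
qed

lemma coeff_op_l2:
  assumes j: "j < d" and x: "x \<in> l2"
  shows "coeff_op \<alpha> j M x \<in> l2"
    and "l2norm (coeff_op \<alpha> j M x) \<le> sqrt (\<alpha>\<^sup>2 * (\<Sum>p<n. \<Sum>q<n. (cmod (M $$ (p, q)))\<^sup>2)) * l2norm x"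
proof -
  let ?F = "\<alpha>\<^sup>2 * (\<Sum>p<n. \<Sum>q<n. (cmod (M $$ (p, q)))\<^sup>2)"
  have F: "0 \<le> ?F" by (simp add: sum_nonneg)
  have le: "(\<Sum>i<K. (cmod (coeff_op \<alpha> j M x i))\<^sup>2) \<le> ?F * (\<Sum>i. (cmod (x i))\<^sup>2)" for K
    using x by (intro order_trans[OF coeff_op_bound[OF j]] mult_left_mono sum_le_suminf F) (auto simp: l2_def)
  thus l2: "coeff_op \<alpha> j M x \<in> l2" unfolding l2_iff_bounded by blast
  have "(\<Sum>i. (cmod (coeff_op \<alpha> j M x i))\<^sup>2) \<le> ?F * (\<Sum>i. (cmod (x i))\<^sup>2)"
    using l2 le by (intro suminf_le_const) (auto simp: l2_def)
  thus "l2norm (coeff_op \<alpha> j M x) \<le> sqrt ?F * l2norm x"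
    unfolding l2norm_def real_sqrt_mult[symmetric] by (rule real_sqrt_le_mono)
qed

lemma lin_to_ops_coeff_op: "j < d \<Longrightarrow> lin_to_ops n (coeff_op \<alpha> j)"
proof -
  assume j: "j < d"
  have "bounded_op (coeff_op \<alpha> j M)" for M
    unfolding bounded_op_def
  proof (intro conjI)
    show "\<forall>x\<in>l2. coeff_op \<alpha> j M x \<in> l2" using coeff_op_l2(1)[OF j] by blast
    show "\<exists>K. \<forall>x\<in>l2. l2norm (coeff_op \<alpha> j M x) \<le> K * l2norm x" using coeff_op_l2(2)[OF j] by blast
  qed (auto simp: coeff_op_def fun_eq_iff algebra_simps)
  thus ?thesis
    unfolding lin_to_ops_def by (auto simp: coeff_op_def fun_eq_iff algebra_simps)
qed

section \<open>Inversion of the pencil by forward substitution\<close>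

definition feedback :: "nat \<Rightarrow> real \<Rightarrow> (nat \<Rightarrow> nat \<Rightarrow> nat \<Rightarrow> nat \<Rightarrow> nat \<Rightarrow> complex) \<Rightarrow> (nat \<Rightarrow> nat \<Rightarrow> complex) \<Rightarrow> nat \<Rightarrow> nat \<Rightarrow> complex" where
  "feedback m \<alpha> W v s i = (if i < n then 0 else of_real \<alpha> * (\<Sum>t<m. W (lj i) (lp i) (lq i) s t * v t (par i)))"

lemma LA_coeff_op:
  assumes "s < m"
  shows "LA d n (coeff_op \<alpha>) m (map (wmat n m W) [0..<d]) v s i = v s i - feedback m \<alpha> W v s i"
proof -
  have b: "blk n (wmat n m W j) s t = mat n n (\<lambda>(p, q). W j p q s t)" if "t < m" for j t
    using assms that by (auto simp: blk_def wmat_index intro!: eq_matI)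
  have "(\<Sum>j<d. \<Sum>t<m. coeff_op \<alpha> j (blk n (map (wmat n m W) [0..<d] ! j) s t) (v t) i)
      = (\<Sum>j<d. if j = lj i then if i < n then 0 else \<Sum>t<m. \<alpha> * (W j (lp i) (lq i) s t * v t (par i)) else 0)"
    by (intro sum.cong refl) (auto simp: coeff_op_def b mult.assoc sum_distrib_left)
  also have "\<dots> = feedback m \<alpha> W v s i" by (simp add: feedback_def sum_distrib_left mult.assoc)
  finally show ?thesis using assms by (simp add: LA_def)
qed

text \<open>\<open>wbound\<close> tested on vectors supported at the single inner index
  \<open>q\<close>.\<close>

lemma wbound_column:
  assumes W: "wbound d n m W \<delta>" and q: "q < n"
  shows "(\<Sum>j<d. \<Sum>s<m. \<Sum>p<n. (cmod (\<Sum>t<m. W j p q s t * x t))\<^sup>2) \<le> \<delta>\<^sup>2 * (\<Sum>t<m. (cmod (x t))\<^sup>2)"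
proof -
  have 1: "(\<Sum>q'<n. W j p q' s t * (if q' = q then x t else 0)) = W j p q s t * x t" for j p s t
  proof -
    have "(\<Sum>q'<n. W j p q' s t * (if q' = q then x t else 0)) = (\<Sum>q'<n. if q' = q then W j p q' s t * x t else 0)"
      by (intro sum.cong) auto
    thus ?thesis using q by simp
  qed
  have 2: "(\<Sum>q'<n. (cmod (if q' = q then x t else 0))\<^sup>2) = (cmod (x t))\<^sup>2" for t
  proof -
    have "(\<Sum>q'<n. (cmod (if q' = q then x t else 0))\<^sup>2) = (\<Sum>q'<n. if q' = q then (cmod (x t))\<^sup>2 else 0)"
      by (intro sum.cong) auto
    thus ?thesis using q by simp
  qed
  from W[unfolded wbound_def, THEN spec, of "\<lambda>t q'. if q' = q then x t else 0"] show ?thesis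
    by (simp only: 1 2)
qed

text \<open>For a fixed parent and a fixed \<open>q\<close>, the letters \<open>(j, p, q)\<close>
  together contribute at most \<open>\<delta>\<^sup>2\<close> by \<open>wbound_column\<close>; the
  \<open>n\<close> values of \<open>q\<close> account for the factor \<open>n\<close>. The swaps
  only bring \<open>q\<close> to the outside.\<close>

lemma feedback_bound:
  assumes W: "wbound d n m W \<delta>"
  shows "(\<Sum>s<m. \<Sum>i<K. (cmod (feedback m \<alpha> W v s i))\<^sup>2) \<le> \<alpha>\<^sup>2 * n * \<delta>\<^sup>2 * (\<Sum>s<m. \<Sum>i<K. (cmod (v s i))\<^sup>2)"
proof -
  define g where "g s i = (cmod (\<Sum>t<m. W (lj i) (lp i) (lq i) s t * v t (par i)))\<^sup>2" for s i
  have "(\<Sum>s<m. \<Sum>i<K. (cmod (feedback m \<alpha> W v s i))\<^sup>2) = (\<Sum>s<m. \<Sum>i<K. \<alpha>\<^sup>2 * (if i < n then 0 else g s i))"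
    by (intro sum.cong refl) (simp add: feedback_def g_def norm_mult power_mult_distrib)
  also have "\<dots> = \<alpha>\<^sup>2 * (\<Sum>i<K. if i < n then 0 else (\<Sum>s<m. g s i))"
    by (subst sum.swap) (auto simp: sum_distrib_left intro!: sum.cong)
  also have "\<dots> \<le> \<alpha>\<^sup>2 * (\<Sum>b<K. \<Sum>j<d. \<Sum>p<n. \<Sum>q<n. \<Sum>s<m. g s (child j p q b))"
    by (intro mult_left_mono sum_children_le) (auto simp: g_def sum_nonneg)
  also have "(\<Sum>b<K. \<Sum>j<d. \<Sum>p<n. \<Sum>q<n. \<Sum>s<m. g s (child j p q b))
      = (\<Sum>b<K. \<Sum>j<d. \<Sum>p<n. \<Sum>q<n. \<Sum>s<m. (cmod (\<Sum>t<m. W j p q s t * v t b))\<^sup>2)"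
    by (intro sum.cong refl) (simp add: g_def)
  also have "\<dots> = (\<Sum>b<K. \<Sum>j<d. \<Sum>q<n. \<Sum>p<n. \<Sum>s<m. (cmod (\<Sum>t<m. W j p q s t * v t b))\<^sup>2)"
    by (rule sum.cong[OF refl], rule sum.cong[OF refl], rule sum.swap)
  also have "\<dots> = (\<Sum>b<K. \<Sum>q<n. \<Sum>j<d. \<Sum>p<n. \<Sum>s<m. (cmod (\<Sum>t<m. W j p q s t * v t b))\<^sup>2)"
    by (rule sum.cong[OF refl], rule sum.swap)
  also have "\<dots> = (\<Sum>b<K. \<Sum>q<n. \<Sum>j<d. \<Sum>s<m. \<Sum>p<n. (cmod (\<Sum>t<m. W j p q s t * v t b))\<^sup>2)"
    by (rule sum.cong[OF refl], rule sum.cong[OF refl], rule sum.cong[OF refl], rule sum.swap)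
  also have "\<dots> \<le> (\<Sum>b<K. \<Sum>q<n. \<delta>\<^sup>2 * (\<Sum>t<m. (cmod (v t b))\<^sup>2))"
    by (intro sum_mono wbound_column W) simp
  also have "\<dots> = n * \<delta>\<^sup>2 * (\<Sum>s<m. \<Sum>i<K. (cmod (v s i))\<^sup>2)"
    by (subst sum.swap[of _ "{..<K}" "{..<m}"]) (simp add: sum_distrib_left mult.assoc)
  finally show ?thesis by (simp add: mult_left_mono mult.assoc)
qed

text \<open>Each node is computed from its parent, so a formal solution exists for every
  \<open>W\<close> and every right-hand side \<open>w\<close>; smallness of \<open>W\<close> enters
  later, for square-summability.\<close>

function solution :: "nat \<Rightarrow> real \<Rightarrow> (nat \<Rightarrow> nat \<Rightarrow> nat \<Rightarrow> nat \<Rightarrow> nat \<Rightarrow> complex) \<Rightarrow> (nat \<Rightarrow> nat \<Rightarrow> complex) \<Rightarrow> nat \<Rightarrow> nat \<Rightarrow> complex" where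
  "solution m \<alpha> W w i s = w s i + (if i < n then 0 else
     of_real \<alpha> * (\<Sum>t<m. W (lj i) (lp i) (lq i) s t * solution m \<alpha> W w (par i) t))"
  by pat_completeness auto
termination
  by (relation "measure (\<lambda>(m, \<alpha>, W, w, i, s). i)") (auto simp: par_less)

declare solution.simps [simp del]

lemma l2m_bounded:
  assumes "w \<in> l2m m"
  shows "\<exists>C\<ge>0. \<forall>K. (\<Sum>s<m. \<Sum>i<K. (cmod (w s i))\<^sup>2) \<le> C"
proof -
  have "(\<Sum>s<m. \<Sum>i<K. (cmod (w s i))\<^sup>2) \<le> (\<Sum>s<m. \<Sum>i. (cmod (w s i))\<^sup>2)" for K
    using assms by (intro sum_mono sum_le_suminf) (auto simp: l2m_def l2_def)
  moreover have "0 \<le> (\<Sum>s<m. \<Sum>i. (cmod (w s i))\<^sup>2)"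
    using assms by (intro sum_nonneg suminf_nonneg) (auto simp: l2m_def l2_def)
  ultimately show ?thesis by blast
qed

lemma l2m_if_bounded:
  fixes m :: nat
  assumes "\<And>K. (\<Sum>s<m. \<Sum>i<K. (cmod (v s i))\<^sup>2) \<le> C" and s: "s < m"
  shows "v s \<in> l2"
proof -
  have "(\<Sum>i<K. (cmod (v s i))\<^sup>2) \<le> C" for K
  proof -
    have "(\<Sum>i<K. (cmod (v s i))\<^sup>2) \<le> (\<Sum>s<m. \<Sum>i<K. (cmod (v s i))\<^sup>2)"
      using s by (intro member_le_sum[of s "{..<m}" "\<lambda>s. \<Sum>i<K. (cmod (v s i))\<^sup>2"]) (auto intro: sum_nonneg)
    thus ?thesis using assms(1)[of K] by linarith
  qed
  thus ?thesis unfolding l2_iff_bounded by blast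
qed

context
  fixes m :: nat and \<alpha> \<delta> :: real and W :: "nat \<Rightarrow> nat \<Rightarrow> nat \<Rightarrow> nat \<Rightarrow> nat \<Rightarrow> complex"
  assumes W: "wbound d n m W \<delta>" and small: "\<alpha>\<^sup>2 * n * \<delta>\<^sup>2 \<le> 1 / 4"
begin

lemma feedback_contraction:
  "(\<Sum>s<m. \<Sum>i<K. (cmod (feedback m \<alpha> W v s i))\<^sup>2) \<le> 1 / 4 * (\<Sum>s<m. \<Sum>i<K. (cmod (v s i))\<^sup>2)"
  by (rule order_trans[OF feedback_bound[OF W] mult_right_mono[OF small]]) (simp add: sum_nonneg)

lemma feedback_l2:
  assumes v: "v \<in> l2m m" and s: "s < m"
  shows "feedback m \<alpha> W v s \<in> l2"
proof -
  obtain C where C: "\<And>K. (\<Sum>s<m. \<Sum>i<K. (cmod (v s i))\<^sup>2) \<le> C" using l2m_bounded[OF v] by blast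
  have "(\<Sum>s<m. \<Sum>i<K. (cmod (feedback m \<alpha> W v s i))\<^sup>2) \<le> 1 / 4 * C" for K
    using feedback_contraction[of v K] C[of K] by linarith
  thus ?thesis using s by (rule l2m_if_bounded)
qed

text \<open>On the first \<open>K\<close> nodes the finite sum \<open>S\<close> of squares of
  \<open>v\<close> satisfies \<open>S \<le> 2 * C + 2 * (1 / 4) * S\<close>, hence
  \<open>S \<le> 4 * C\<close>. The absorption is legitimate because \<open>S\<close> is finite
  before square-summability is known.\<close>

lemma solution_l2:
  assumes w: "w \<in> l2m m" and s: "s < m"
    and v: "\<And>s i. s < m \<Longrightarrow> v s i = w s i + feedback m \<alpha> W v s i"
  shows "v s \<in> l2"
proof -
  obtain C where C: "\<And>K. (\<Sum>s<m. \<Sum>i<K. (cmod (w s i))\<^sup>2) \<le> C" using l2m_bounded[OF w] by blast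
  have "(\<Sum>s<m. \<Sum>i<K. (cmod (v s i))\<^sup>2) \<le> 4 * C" for K
  proof -
    have "(\<Sum>s<m. \<Sum>i<K. (cmod (v s i))\<^sup>2) \<le> (\<Sum>s<m. \<Sum>i<K. 2 * (cmod (w s i))\<^sup>2 + 2 * (cmod (feedback m \<alpha> W v s i))\<^sup>2)"
    proof (intro sum_mono)
      fix s i assume "s \<in> {..<m}"
      thus "(cmod (v s i))\<^sup>2 \<le> 2 * (cmod (w s i))\<^sup>2 + 2 * (cmod (feedback m \<alpha> W v s i))\<^sup>2"
        using v[of s i] cmod_add_sq_le[of "w s i" "feedback m \<alpha> W v s i"] by simp
    qed
    also have "\<dots> = 2 * (\<Sum>s<m. \<Sum>i<K. (cmod (w s i))\<^sup>2) + 2 * (\<Sum>s<m. \<Sum>i<K. (cmod (feedback m \<alpha> W v s i))\<^sup>2)"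
      by (simp add: sum.distrib sum_distrib_left)
    finally show ?thesis using feedback_contraction[of v K] C[of K] by linarith
  qed
  thus ?thesis using s by (rule l2m_if_bounded)
qed

lemma LA_preimage:
  assumes w: "w \<in> l2m m"
  obtains v where "v \<in> l2m m" "LA d n (coeff_op \<alpha>) m (map (wmat n m W) [0..<d]) v = w"
    "\<And>s i. s < m \<Longrightarrow> v s i = w s i + feedback m \<alpha> W v s i"
proof -
  define v where "v s = (if s < m then (\<lambda>i. solution m \<alpha> W w i s) else (\<lambda>_. 0))" for s
  have eq: "v s i = w s i + feedback m \<alpha> W v s i" if "s < m" for s i
    using that by (simp add: v_def feedback_def solution.simps[of m \<alpha> W w i s])
  have "v \<in> l2m m"
    using solution_l2[OF w _ eq] by (simp add: l2m_def) (simp add: v_def)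
  moreover have "LA d n (coeff_op \<alpha>) m (map (wmat n m W) [0..<d]) v = w"
  proof (intro ext)
    fix s i
    show "LA d n (coeff_op \<alpha>) m (map (wmat n m W) [0..<d]) v s i = w s i"
      using eq[of s i] w by (cases "s < m") (simp_all add: LA_coeff_op, simp add: LA_def l2m_def)
  qed
  ultimately show thesis using eq by (rule that)
qed

lemma LA_bij: "bij_betw (LA d n (coeff_op \<alpha>) m (map (wmat n m W) [0..<d])) (l2m m) (l2m m)"
proof (rule bij_betwI')
  let ?L = "LA d n (coeff_op \<alpha>) m (map (wmat n m W) [0..<d])"
  fix v v' assume v: "v \<in> l2m m" "v' \<in> l2m m"
  show "(?L v = ?L v') = (v = v')"
  proof
    assume eq: "?L v = ?L v'"
    \<comment> \<open>The feedback at \<open>i\<close> reads only \<open>par i\<close>, so two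
      preimages agree node by node, starting from the roots where the feedback vanishes.\<close>
    have "\<forall>s<m. v s i = v' s i" for i
    proof (induction i rule: less_induct)
      case (less i)
      have "feedback m \<alpha> W v s i = feedback m \<alpha> W v' s i" for s
        using less[of "par i"] par_less[of i] by (auto simp: feedback_def intro!: sum.cong)
      moreover have "v s i - feedback m \<alpha> W v s i = v' s i - feedback m \<alpha> W v' s i" if "s < m" for s
        using eq LA_coeff_op[OF that] by metis
      ultimately show ?case by simp
    qed
    hence agree: "v s i = v' s i" if "s < m" for s i using that by blast
    show "v = v'"
    proof (intro ext)
      fix s i
      show "v s i = v' s i" using v agree by (cases "s < m") (simp_all add: l2m_def)
    qed
  qed simp
next
  let ?L = "LA d n (coeff_op \<alpha>) m (map (wmat n m W) [0..<d])"
  fix v assume v: "v \<in> l2m m"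
  have "?L v s = (\<lambda>i. v s i - feedback m \<alpha> W v s i)" if "s < m" for s
    using that by (intro ext) (rule LA_coeff_op)
  thus "?L v \<in> l2m m"
    using v feedback_l2[OF v] by (auto simp: l2m_def intro!: l2_diff) (auto simp: LA_def)
next
  fix w assume w: "w \<in> l2m m"
  show "\<exists>v\<in>l2m m. w = LA d n (coeff_op \<alpha>) m (map (wmat n m W) [0..<d]) v"
    using LA_preimage[OF w] by metis
qed

end

end

section \<open>The augmented point\<close>

lemma cauchy_schwarz_cmod2:
  fixes a u :: "nat \<Rightarrow> nat \<Rightarrow> complex"
  shows "(cmod (\<Sum>b<I. \<Sum>q<n. a b q * u b q))\<^sup>2
    \<le> (\<Sum>b<I. \<Sum>q<n. (cmod (a b q))\<^sup>2) * (\<Sum>b<I. \<Sum>q<n. (cmod (u b q))\<^sup>2)"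
  using cauchy_schwarz_cmod[of "\<lambda>(b, q). a b q" "\<lambda>(b, q). u b q" "{..<I} \<times> {..<n}"]
  by (simp add: sum.cartesian_product split_beta)

lemma opnorm_blocks:
  assumes M: "M \<in> carrier_mat (A * n) (A * n)" and A: "0 < A * n" and B: "opnorm M \<le> B"
  shows "(\<Sum>a<A. \<Sum>p<n. (cmod (\<Sum>b<A. \<Sum>q<n. M $$ (a * n + p, b * n + q) * u b q))\<^sup>2)
    \<le> B\<^sup>2 * (\<Sum>b<A. \<Sum>q<n. (cmod (u b q))\<^sup>2)"
proof -
  have "\<forall>N\<in>set [M]. N \<in> carrier_mat (A * n) (A * n)" using M by simp
  note c = colbd_colnorm[OF this _ A]
  have "colbd [M] B" using c B by (auto simp: opnorm_def intro: colbd_mono)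
  from colbd_blocks[OF _ _ this, of A n u] M show ?thesis by simp
qed

context node_coding
begin

text \<open>The first \<open>A\<close> rows of \<open>W'\<close> vanish beyond column
  \<open>A\<close>, so \<open>T = [1, 0]\<close> intertwines the corner \<open>W\<close> with
  \<open>W'\<close>, and \<open>f\<close> of the corner is the corner of \<open>f\<close>.\<close>

lemma tup_truncation:
  assumes f: "nc_function d \<Omega> f"
    and Y: "length Y = d" "\<forall>M\<in>set Y. M \<in> carrier_mat n n"
    and X: "tup d n Y A W \<in> \<Omega>" "tup d n Y A' W' \<in> \<Omega>" and A: "A \<le> A'"
    and W: "\<And>j p q a b. \<lbrakk>j < d; p < n; q < n; a < A; b < A'\<rbrakk> \<Longrightarrow>
      W' j p q a b = (if b < A then W j p q a b else 0)"
    and b: "a < A" "b < A" "p < n" "q < n"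
  shows "f (tup d n Y A W) $$ (a * n + p, b * n + q) = f (tup d n Y A' W') $$ (a * n + p, b * n + q)"
proof -
  let ?T = "\<lambda>a b. if a = b then 1 else 0 :: complex"
  have left: "(\<Sum>c<A. g c * ?T c b) = (if b < A then g b else 0)" for g :: "nat \<Rightarrow> complex" and b
  proof -
    have "(\<Sum>c<A. g c * ?T c b) = (\<Sum>c<A. if c = b then g c else 0)" by (intro sum.cong) auto
    thus ?thesis by simp
  qed
  have right: "(\<Sum>c<A'. ?T a c * g c) = g a" if "a < A" for g :: "nat \<Rightarrow> complex" and a
  proof -
    have "(\<Sum>c<A'. ?T a c * g c) = (\<Sum>c<A'. if c = a then g c else 0)" by (intro sum.cong) auto
    thus ?thesis using that A by simp
  qed
  have "(\<Sum>c<A. f (tup d n Y A W) $$ (a * n + p, c * n + q) * ?T c b)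
       = (\<Sum>c<A'. ?T a c * f (tup d n Y A' W') $$ (c * n + p, b * n + q))"
  proof (rule tup_intertwining[OF f d_pos Y X])
    fix j p q a b assume "j < d" "p < n" "q < n" "a < A" "b < A'"
    thus "(\<Sum>c<A. W j p q a c * ?T c b) = (\<Sum>c<A'. ?T a c * W' j p q c b)"
      by (simp only: left right W)
  qed (use b A in auto)
  thus ?thesis using b by (simp only: left right if_True)
qed

lemma shift_wbound: "wbound d n I (shift \<rho>) (\<rho> * d * n)"
  unfolding wbound_def
proof
  fix u :: "nat \<Rightarrow> nat \<Rightarrow> complex"
  \<comment> \<open>\<open>shift_bound\<close> gives the norm bound
    \<open>\<rho> * sqrt (d * n)\<close>; rounding it up to \<open>\<rho> * d * n\<close> removes
    the root.\<close>
  have "real (d * n) * 1 \<le> real (d * n) * real (d * n)"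
    using d_pos n_pos by (intro mult_left_mono) (auto simp: Suc_leI simp flip: of_nat_mult)
  from mult_left_mono[OF this, of "\<rho>\<^sup>2"] have "\<rho>\<^sup>2 * (d * n) \<le> (\<rho> * d * n)\<^sup>2"
    by (simp add: power2_eq_square mult_ac)
  hence "\<rho>\<^sup>2 * (d * n) * (\<Sum>b<I. \<Sum>q<n. (cmod (u b q))\<^sup>2) \<le> (\<rho> * d * n)\<^sup>2 * (\<Sum>b<I. \<Sum>q<n. (cmod (u b q))\<^sup>2)"
    by (intro mult_right_mono sum_nonneg) auto
  with shift_bound[where \<rho> = \<rho> and I = I and u = u]
  show "(\<Sum>j<d. \<Sum>a<I. \<Sum>p<n. (cmod (\<Sum>b<I. \<Sum>q<n. shift \<rho> j p q a b * u b q))\<^sup>2)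
    \<le> (\<rho> * d * n)\<^sup>2 * (\<Sum>b<I. \<Sum>q<n. (cmod (u b q))\<^sup>2)" by linarith
qed

definition remainder :: "nat \<Rightarrow> real \<Rightarrow> (nat \<Rightarrow> nat \<Rightarrow> complex) \<Rightarrow> nat \<Rightarrow> nat \<Rightarrow> nat \<Rightarrow> nat \<Rightarrow> nat \<Rightarrow> complex" where
  "remainder I \<kappa> v j p q s b = (if child j p q b < I then 0 else of_real \<kappa> * v s (child j p q b))"

text \<open>Cauchy-Schwarz reduces the claim to the Hilbert-Schmidt norm. A node is the child of one
  parent along one letter, so each tail entry of \<open>v\<close> is counted at most once, and the
  scale \<open>\<rho> / \<epsilon>\<close> turns the tail bound into \<open>\<rho>\<close>.\<close>

lemma remainder_bound:
  assumes eps: "0 < \<epsilon>" and tail: "\<And>M. (\<Sum>s<m. \<Sum>i<M. if i < I then 0 else (cmod (v s i))\<^sup>2) \<le> \<epsilon>\<^sup>2"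
  shows "(\<Sum>j<d. \<Sum>s<m. \<Sum>p<n. (cmod (\<Sum>b<I. \<Sum>q<n. remainder I (\<rho> / \<epsilon>) v j p q s b * u b q))\<^sup>2)
    \<le> \<rho>\<^sup>2 * (\<Sum>b<I. \<Sum>q<n. (cmod (u b q))\<^sup>2)"
proof -
  let ?E = "\<Sum>b<I. \<Sum>q<n. (cmod (u b q))\<^sup>2"
  \<comment> \<open>The children of the first \<open>I\<close> nodes are exactly the nodes from
    \<open>n\<close> up to \<open>M\<close>.\<close>
  define M where "M = n + I * d * n * n"
  define g where "g s i = (if i < I then 0 else (\<rho> / \<epsilon>)\<^sup>2 * (cmod (v s i))\<^sup>2)" for s i
  have g: "(cmod (remainder I (\<rho> / \<epsilon>) v j p q s b))\<^sup>2 = g s (child j p q b)" for j p q s b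
    by (simp add: remainder_def g_def norm_mult norm_divide power_mult_distrib power_divide)
  have "(\<Sum>j<d. \<Sum>s<m. \<Sum>p<n. (cmod (\<Sum>b<I. \<Sum>q<n. remainder I (\<rho> / \<epsilon>) v j p q s b * u b q))\<^sup>2)
      \<le> (\<Sum>j<d. \<Sum>s<m. \<Sum>p<n. (\<Sum>b<I. \<Sum>q<n. g s (child j p q b)) * ?E)"
    unfolding g[symmetric] by (intro sum_mono cauchy_schwarz_cmod2)
  also have "\<dots> = (\<Sum>j<d. \<Sum>s<m. \<Sum>p<n. \<Sum>b<I. \<Sum>q<n. g s (child j p q b)) * ?E"
    by (simp only: sum_distrib_right)
  also have "(\<Sum>j<d. \<Sum>s<m. \<Sum>p<n. \<Sum>b<I. \<Sum>q<n. g s (child j p q b))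
      = (\<Sum>j<d. \<Sum>s<m. \<Sum>b<I. \<Sum>p<n. \<Sum>q<n. g s (child j p q b))"
    by (rule sum.cong[OF refl], rule sum.cong[OF refl], rule sum.swap)
  also have "\<dots> = (\<Sum>s<m. \<Sum>j<d. \<Sum>b<I. \<Sum>p<n. \<Sum>q<n. g s (child j p q b))"
    by (rule sum.swap)
  also have "\<dots> = (\<Sum>s<m. \<Sum>b<I. \<Sum>j<d. \<Sum>p<n. \<Sum>q<n. g s (child j p q b))"
    by (rule sum.cong[OF refl], rule sum.swap)
  also have "\<dots> = (\<Sum>s<m. \<Sum>i<M. if i < n then 0 else g s i)"
    by (simp only: sum_children M_def)
  also have "\<dots> \<le> (\<Sum>s<m. \<Sum>i<M. (\<rho> / \<epsilon>)\<^sup>2 * (if i < I then 0 else (cmod (v s i))\<^sup>2))"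
    by (intro sum_mono) (simp add: g_def)
  also have "\<dots> = (\<rho> / \<epsilon>)\<^sup>2 * (\<Sum>s<m. \<Sum>i<M. if i < I then 0 else (cmod (v s i))\<^sup>2)"
    by (simp only: sum_distrib_left)
  also have "\<dots> \<le> (\<rho> / \<epsilon>)\<^sup>2 * \<epsilon>\<^sup>2"
    by (intro mult_left_mono tail) simp
  also have "\<dots> = \<rho>\<^sup>2" using eps by (simp add: power_divide)
  finally show ?thesis by (simp add: mult_right_mono sum_nonneg)
qed

text \<open>The block matrix with rows \<open>[shift, 0]\<close> and \<open>[remainder, W]\<close>.
  The zero block lets \<open>tup_truncation\<close> recover the pure shift; the corner
  \<open>W\<close> is what \<open>\<epsilon>\<close> times the identity intertwines with
  \<open>W\<close>.\<close>

definition augment :: "nat \<Rightarrow> real \<Rightarrow> real \<Rightarrow> (nat \<Rightarrow> nat \<Rightarrow> complex) \<Rightarrow> (nat \<Rightarrow> nat \<Rightarrow> nat \<Rightarrow> nat \<Rightarrow> nat \<Rightarrow> complex)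
    \<Rightarrow> nat \<Rightarrow> nat \<Rightarrow> nat \<Rightarrow> nat \<Rightarrow> nat \<Rightarrow> complex" where
  "augment I \<rho> \<epsilon> v W j p q a b = (if a < I then (if b < I then shift \<rho> j p q a b else 0)
     else (if b < I then remainder I (\<rho> / \<epsilon>) v j p q (a - I) b else W j p q (a - I) (b - I)))"

lemma augment_wbound:
  assumes eps: "0 < \<epsilon>" and tail: "\<And>M. (\<Sum>s<m. \<Sum>i<M. if i < I then 0 else (cmod (v s i))\<^sup>2) \<le> \<epsilon>\<^sup>2"
    and W: "wbound d n m W \<delta>" and \<delta>: "0 \<le> \<delta>" "\<delta> \<le> \<rho>"
  shows "wbound d n (I + m) (augment I \<rho> \<epsilon> v W) (2 * \<rho> * d * n)"
  unfolding wbound_def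
proof
  fix u :: "nat \<Rightarrow> nat \<Rightarrow> complex"
  define u' where "u' t = u (I + t)" for t
  let ?E = "\<Sum>b<I. \<Sum>q<n. (cmod (u b q))\<^sup>2" and ?E' = "\<Sum>t<m. \<Sum>q<n. (cmod (u' t q))\<^sup>2"
  let ?S = "\<lambda>j a p. \<Sum>b<I. \<Sum>q<n. shift \<rho> j p q a b * u b q"
  let ?R = "\<lambda>j s p. \<Sum>b<I. \<Sum>q<n. remainder I (\<rho> / \<epsilon>) v j p q s b * u b q"
  let ?W = "\<lambda>j s p. \<Sum>t<m. \<Sum>q<n. W j p q s t * u' t q"
  have E: "0 \<le> ?E" "0 \<le> ?E'" by (auto intro!: sum_nonneg)
  have top: "(\<Sum>b<I + m. \<Sum>q<n. augment I \<rho> \<epsilon> v W j p q a b * u b q) = ?S j a p" if "a < I" for j a p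
    using that by (simp add: sum_lessThan_add augment_def)
  have bot: "(\<Sum>b<I + m. \<Sum>q<n. augment I \<rho> \<epsilon> v W j p q (I + s) b * u b q) = ?R j s p + ?W j s p" for j s p
    by (simp add: sum_lessThan_add augment_def u'_def)
  have split: "(\<Sum>j<d. \<Sum>s<m. \<Sum>p<n. 2 * g j s p + 2 * h j s p)
      = 2 * (\<Sum>j<d. \<Sum>s<m. \<Sum>p<n. g j s p) + 2 * (\<Sum>j<d. \<Sum>s<m. \<Sum>p<n. h j s p)"
    for g h :: "nat \<Rightarrow> nat \<Rightarrow> nat \<Rightarrow> real"
    by (simp add: sum.distrib sum_distrib_left)
  define G where "G j a = (\<Sum>p<n. (cmod (\<Sum>b<I + m. \<Sum>q<n. augment I \<rho> \<epsilon> v W j p q a b * u b q))\<^sup>2)" for j a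
  have "(\<Sum>j<d. \<Sum>a<I + m. G j a) = (\<Sum>j<d. \<Sum>a<I. G j a) + (\<Sum>j<d. \<Sum>s<m. G j (I + s))"
    by (simp only: sum_lessThan_add sum.distrib)
  also have "(\<Sum>j<d. \<Sum>a<I. G j a) = (\<Sum>j<d. \<Sum>a<I. \<Sum>p<n. (cmod (?S j a p))\<^sup>2)"
    by (intro sum.cong refl) (simp add: G_def top)
  also have "(\<Sum>j<d. \<Sum>s<m. G j (I + s)) = (\<Sum>j<d. \<Sum>s<m. \<Sum>p<n. (cmod (?R j s p + ?W j s p))\<^sup>2)"
    by (simp only: G_def bot)
  finally have G: "(\<Sum>j<d. \<Sum>a<I + m. G j a) = (\<Sum>j<d. \<Sum>a<I. \<Sum>p<n. (cmod (?S j a p))\<^sup>2)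
      + (\<Sum>j<d. \<Sum>s<m. \<Sum>p<n. (cmod (?R j s p + ?W j s p))\<^sup>2)" .
  have "(\<Sum>j<d. \<Sum>s<m. \<Sum>p<n. (cmod (?R j s p + ?W j s p))\<^sup>2)
      \<le> (\<Sum>j<d. \<Sum>s<m. \<Sum>p<n. 2 * (cmod (?R j s p))\<^sup>2 + 2 * (cmod (?W j s p))\<^sup>2)"
    by (intro sum_mono cmod_add_sq_le)
  also have "\<dots> = 2 * (\<Sum>j<d. \<Sum>s<m. \<Sum>p<n. (cmod (?R j s p))\<^sup>2) + 2 * (\<Sum>j<d. \<Sum>s<m. \<Sum>p<n. (cmod (?W j s p))\<^sup>2)"
    by (rule split)
  finally have "(\<Sum>j<d. \<Sum>s<m. \<Sum>p<n. (cmod (?R j s p + ?W j s p))\<^sup>2)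
      \<le> 2 * (\<Sum>j<d. \<Sum>s<m. \<Sum>p<n. (cmod (?R j s p))\<^sup>2) + 2 * (\<Sum>j<d. \<Sum>s<m. \<Sum>p<n. (cmod (?W j s p))\<^sup>2)" .
  hence "(\<Sum>j<d. \<Sum>a<I + m. G j a)
      \<le> \<rho>\<^sup>2 * (d * n) * ?E + (2 * (\<rho>\<^sup>2 * ?E) + 2 * (\<delta>\<^sup>2 * ?E'))"
    using G shift_bound[where \<rho> = \<rho> and I = I and u = u]
      remainder_bound[OF eps tail, where \<rho> = \<rho> and u = u]
      W[unfolded wbound_def, THEN spec, of u'] by linarith
  also have "\<dots> \<le> (2 * \<rho> * d * n)\<^sup>2 * (?E + ?E')"
  proof -
    define D where "D = real (d * n)"
    have D: "1 \<le> D" using d_pos n_pos by (simp add: D_def Suc_leI flip: of_nat_mult)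
    have "D * 1 \<le> D * D" using D by (intro mult_left_mono) auto
    \<comment> \<open>The factor 2 in the radius comes from here: its square 4 dominates both the
      coefficient \<open>D + 2\<close> of the node part and the coefficient 2 of the part in the
      \<open>m\<close> slots.\<close>
    hence DD: "D + 2 \<le> 4 * (D * D)" "2 \<le> 4 * (D * D)" using D by linarith+
    have "\<delta>\<^sup>2 \<le> \<rho>\<^sup>2" using \<delta> by (intro power_mono)
    hence 1: "2 * (\<delta>\<^sup>2 * ?E') \<le> 2 * (\<rho>\<^sup>2 * ?E')" using E by (simp add: mult_right_mono)
    have "\<rho>\<^sup>2 * D * ?E + (2 * (\<rho>\<^sup>2 * ?E) + 2 * (\<rho>\<^sup>2 * ?E')) = \<rho>\<^sup>2 * ((D + 2) * ?E + 2 * ?E')"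
      by (simp add: algebra_simps)
    also have "\<dots> \<le> \<rho>\<^sup>2 * (4 * (D * D) * ?E + 4 * (D * D) * ?E')"
      by (intro mult_left_mono add_mono mult_right_mono DD E zero_le_power2)
    also have "\<dots> = (2 * \<rho> * d * n)\<^sup>2 * (?E + ?E')"
      by (simp add: D_def power2_eq_square algebra_simps)
    finally show ?thesis using 1 unfolding D_def by linarith
  qed
  also have "?E + ?E' = (\<Sum>b<I + m. \<Sum>q<n. (cmod (u b q))\<^sup>2)"
    by (simp add: sum_lessThan_add u'_def)
  finally show "(\<Sum>j<d. \<Sum>a<I + m. \<Sum>p<n. (cmod (\<Sum>b<I + m. \<Sum>q<n. augment I \<rho> \<epsilon> v W j p q a b * u b q))\<^sup>2)
    \<le> (2 * \<rho> * d * n)\<^sup>2 * (\<Sum>b<I + m. \<Sum>q<n. (cmod (u b q))\<^sup>2)" unfolding G_def .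
qed

text \<open>In a node column \<open>b\<close>, the left side is
  \<open>\<rho> * v s (child j p q b)\<close> by the recursion. If that child is retained,
  \<open>shift\<close> produces this value; if it is discarded, \<open>remainder\<close> does, with
  \<open>\<epsilon>\<close> cancelling. In the last \<open>m\<close> columns both sides are
  \<open>\<epsilon> * W\<close>. Roots are nobody's child, so their values are free and can carry
  the right-hand side.\<close>

lemma augment_intertwining:
  assumes eps: "0 < \<epsilon>" and \<rho>: "0 < \<rho>" and I: "n \<le> I"
    and v: "\<And>s i. s < m \<Longrightarrow> n \<le> i \<Longrightarrow> v s i = feedback m (1 / \<rho>) W v s i"
    and jpq: "j < d" "p < n" "q < n" and s: "s < m" and b: "b < I + m"
  defines "T \<equiv> \<lambda>s b. if b < I then v s b else if b - I = s then of_real \<epsilon> else 0"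
  shows "(\<Sum>c<m. W j p q s c * T c b) = (\<Sum>c<I + m. T s c * augment I \<rho> \<epsilon> v W j p q c b)"
proof (cases "b < I")
  case True
  have "v s (child j p q b) = (1 / \<rho>) * (\<Sum>t<m. W j p q s t * v t b)"
    using v[OF s, of "child j p q b"] jpq by (simp add: feedback_def)
  hence "(\<Sum>c<m. W j p q s c * T c b) = \<rho> * v s (child j p q b)"
    using \<rho> True by (simp add: T_def)
  also have "\<dots> = (\<Sum>c<I. v s c * shift \<rho> j p q c b) + (\<Sum>c<m. (if c = s then of_real \<epsilon> else 0) * remainder I (\<rho> / \<epsilon>) v j p q c b)"
  proof -
    have "(\<Sum>c<I. v s c * shift \<rho> j p q c b) = (\<Sum>c<I. if c = child j p q b then \<rho> * v s c else 0)"
      by (intro sum.cong) (auto simp: shift_def)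
    also have "\<dots> = (if child j p q b < I then \<rho> * v s (child j p q b) else 0)" by simp
    moreover have "(\<Sum>c<m. (if c = s then of_real \<epsilon> else 0) * remainder I (\<rho> / \<epsilon>) v j p q c b)
        = (\<Sum>c<m. if c = s then \<epsilon> * remainder I (\<rho> / \<epsilon>) v j p q c b else 0)"
      by (intro sum.cong) auto
    ultimately show ?thesis using s eps by (simp add: remainder_def)
  qed
  also have "\<dots> = (\<Sum>c<I + m. T s c * augment I \<rho> \<epsilon> v W j p q c b)"
    using True by (simp add: sum_lessThan_add T_def augment_def)
  finally show ?thesis .
next
  case False
  have "(\<Sum>c<m. W j p q s c * T c b) = (\<Sum>c<m. if c = b - I then \<epsilon> * W j p q s c else 0)"
    using False by (intro sum.cong) (auto simp: T_def)
  also have "\<dots> = \<epsilon> * W j p q s (b - I)" using b False by (simp add: less_diff_conv2)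
  also have "\<dots> = (\<Sum>c<m. if c = s then \<epsilon> * W j p q c (b - I) else 0)" using s by simp
  also have "\<dots> = (\<Sum>c<m. (if c = s then of_real \<epsilon> else 0) * W j p q c (b - I))"
    by (intro sum.cong) auto
  also have "\<dots> = (\<Sum>c<I + m. T s c * augment I \<rho> \<epsilon> v W j p q c b)"
    using False by (simp add: sum_lessThan_add T_def augment_def)
  finally show ?thesis .
qed

end

section \<open>Convergence of the expansion\<close>

lemma tail_sum_le:
  fixes g :: "nat \<Rightarrow> real"
  assumes "summable g" "\<And>i. 0 \<le> g i"
  shows "(\<Sum>i<M. if i < I then 0 else g i) \<le> suminf g - (\<Sum>i<I. g i)"
proof -
  have "(\<Sum>i<M. if i < I then 0 else g i) + (\<Sum>i<I. g i)
      \<le> (\<Sum>i<I + M. if i < I then 0 else g i) + (\<Sum>i<I. g i)"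
    using assms(2) by (intro add_right_mono sum_mono2) auto
  also have "\<dots> = (\<Sum>i<I + M. g i)" by (simp add: sum_lessThan_add)
  also have "\<dots> \<le> suminf g" using assms by (intro sum_le_suminf) auto
  finally show ?thesis by simp
qed

text \<open>The quantity compared with \<open>r\<close> is the bound of
  \<open>augment_wbound\<close>, so all augmented points, whatever the cut, lie in the ball where
  \<open>B\<close> bounds \<open>f\<close>.\<close>

locale nc_expansion = node_coding +
  fixes Y :: "complex mat list" and \<Omega> :: "complex mat list set" and f :: "complex mat list \<Rightarrow> complex mat"
    and r B \<rho> :: real
  assumes f: "nc_function d \<Omega> f"
    and Y: "length Y = d" "\<forall>M\<in>set Y. M \<in> carrier_mat n n"
    and ball: "ubasic d Y r \<subseteq> \<Omega>" and bounded: "\<And>Z. Z \<in> ubasic d Y r \<Longrightarrow> opnorm (f Z) \<le> B"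
    and \<rho>: "0 < \<rho>" "2 * \<rho> * d * n < r"
begin

lemma dn_ge_1: "1 \<le> real d * real n"
  using d_pos n_pos by (simp add: Suc_leI flip: of_nat_mult)

lemma rho_less: "\<rho> * d * n < r" "\<rho> < r"
proof -
  have "\<rho> * 1 \<le> \<rho> * (real d * real n)" using \<rho>(1) dn_ge_1 by (intro mult_left_mono) auto
  moreover have "2 * (\<rho> * (real d * real n)) < r" using \<rho>(2) by (simp add: mult.assoc)
  ultimately have "\<rho> * (real d * real n) < r \<and> \<rho> < r" using \<rho>(1) by linarith
  thus "\<rho> * d * n < r" "\<rho> < r" by (simp_all add: mult.assoc)
qed

lemma tup_mem:
  assumes "0 < A" "wbound d n A W s" "0 \<le> s" "s < r"
  shows "tup d n Y A W \<in> ubasic d Y r" "tup d n Y A W \<in> \<Omega>"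
  using tup_in_ubasic[OF d_pos n_pos Y assms] ball by auto

text \<open>The operator norm bound is evaluated at the vector \<open>sum_l e_l (x) e_l\<close> over
  the roots \<open>l < n\<close>, whose squared norm is \<open>n\<close>; \<open>n \<le> A\<close>
  ensures that all roots are present.\<close>

lemma diagonal_column_bound:
  assumes W: "wbound d n A W s" "0 \<le> s" "s < r" and A: "n \<le> A"
  shows "(\<Sum>a<A. \<Sum>p<n. (cmod (\<Sum>l<n. f (tup d n Y A W) $$ (a * n + p, l * n + l)))\<^sup>2) \<le> B\<^sup>2 * n"
proof -
  have A0: "0 < A" using A n_pos by simp
  let ?M = "f (tup d n Y A W)"
  define u where "u b q = (if b = q then 1 else 0 :: complex)" for b q :: nat
  note mem = tup_mem[OF A0 W]
  have M: "?M \<in> carrier_mat (A * n) (A * n)"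
    using f mem(2) level_tup[OF d_pos Y, of A W] unfolding nc_function_def by metis
  have delta: "(\<Sum>b<A. \<Sum>q<n. g b q * u b q) = (\<Sum>l<n. g l l)" for g :: "nat \<Rightarrow> nat \<Rightarrow> complex"
  proof -
    have "(\<Sum>b<A. \<Sum>q<n. g b q * u b q) = (\<Sum>q<n. \<Sum>b<A. if b = q then g b q else 0)"
      by (subst sum.swap, intro sum.cong refl) (simp add: u_def)
    also have "\<dots> = (\<Sum>l<n. g l l)" using A by (intro sum.cong) auto
    finally show ?thesis .
  qed
  have "(\<Sum>b<A. \<Sum>q<n. (cmod (u b q))\<^sup>2) = (\<Sum>q<n. \<Sum>b<A. if b = q then 1 else 0)"
    by (subst sum.swap, intro sum.cong refl) (simp add: u_def)
  also have "\<dots> = (\<Sum>q<n. 1)" using A by (intro sum.cong) auto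
  finally have u: "(\<Sum>b<A. \<Sum>q<n. (cmod (u b q))\<^sup>2) = n" by simp
  have "0 < A * n" using A0 n_pos by simp
  from opnorm_blocks[OF M this bounded[OF mem(1)], of u] show ?thesis
    by (simp only: delta u)
qed

section \<open>Coefficients of the expansion\<close>

text \<open>Entries of \<open>f\<close> of a shift tuple applied to \<open>\<Sum>\<^sub>l e\<^sub>l \<otimes> e\<^sub>l\<close>, the sum over the roots. An intertwiner that kills
  all roots but one maps this vector to a single column, so one family of coefficients serves every column.\<close>

definition expansion_coeff :: "nat \<Rightarrow> nat \<Rightarrow> complex" where
  "expansion_coeff k i = (\<Sum>l<n. f (tup d n Y (n + i + 1) (shift \<rho>)) $$ (i * n + k, l * n + l))"

lemma shift_mem: "0 < I \<Longrightarrow> tup d n Y I (shift \<rho>) \<in> \<Omega>"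
  using shift_wbound \<rho>(1) rho_less(1) by (intro tup_mem(2)) auto

text \<open>The size \<open>n + i + 1\<close> in \<open>expansion_coeff\<close> is just one that
  holds all roots and the node \<open>i\<close>. Any other such segment gives the same value, since
  a child inside a segment has its parent there too.\<close>

lemma expansion_coeff_truncation:
  assumes I: "n \<le> I" "i < I" and k: "k < n"
  shows "expansion_coeff k i = (\<Sum>l<n. f (tup d n Y I (shift \<rho>)) $$ (i * n + k, l * n + l))"
proof -
  have trunc: "f (tup d n Y A (shift \<rho>)) $$ (i * n + k, l * n + l) = f (tup d n Y A' (shift \<rho>)) $$ (i * n + k, l * n + l)"
    if A: "A \<le> A'" "n \<le> A" "i < A" and l: "l < n" for A A' l
  proof (rule tup_truncation[OF f Y])
    fix j p q a b assume "j < d" "p < n" "q < n" "a < A" "b < A'"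
    thus "shift \<rho> j p q a b = (if b < A then shift \<rho> j p q a b else 0)"
      using less_child[of j p q b] by (auto simp: shift_def)
  qed (use A l k n_pos in \<open>auto intro!: shift_mem\<close>)
  show ?thesis
    unfolding expansion_coeff_def
  proof (intro sum.cong refl)
    fix l assume "l \<in> {..<n}"
    thus "f (tup d n Y (n + i + 1) (shift \<rho>)) $$ (i * n + k, l * n + l) = f (tup d n Y I (shift \<rho>)) $$ (i * n + k, l * n + l)"
      using trunc[of "n + i + 1" I l] trunc[of I "n + i + 1" l] I by (cases "n + i + 1 \<le> I") auto
  qed
qed

lemma expansion_coeff_l2:
  assumes k: "k < n"
  shows "(\<lambda>i. cnj (expansion_coeff k i)) \<in> l2"
proof -
  have "(\<Sum>i<K. (cmod (expansion_coeff k i))\<^sup>2) \<le> B\<^sup>2 * n" for K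
  proof -
    \<comment> \<open>One segment holding all roots and the first \<open>K\<close> nodes, so that
      all these coefficients are entries of the same bounded vector.\<close>
    let ?I = "n + K"
    let ?g = "\<lambda>i p. (cmod (\<Sum>l<n. f (tup d n Y ?I (shift \<rho>)) $$ (i * n + p, l * n + l)))\<^sup>2"
    have "(\<Sum>i<K. (cmod (expansion_coeff k i))\<^sup>2) \<le> (\<Sum>i<K. \<Sum>p<n. ?g i p)"
    proof (intro sum_mono)
      fix i assume "i \<in> {..<K}"
      hence "(cmod (expansion_coeff k i))\<^sup>2 = ?g i k"
        using k by (subst expansion_coeff_truncation[of ?I]) auto
      also have "\<dots> \<le> (\<Sum>p<n. ?g i p)" using k by (intro member_le_sum[of k "{..<n}" "?g i"]) auto
      finally show "(cmod (expansion_coeff k i))\<^sup>2 \<le> (\<Sum>p<n. ?g i p)" .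
    qed
    also have "\<dots> \<le> (\<Sum>i<?I. \<Sum>p<n. ?g i p)" by (intro sum_mono2) (auto intro: sum_nonneg)
    also have "\<dots> \<le> B\<^sup>2 * n"
      using \<rho>(1) rho_less(1) by (intro diagonal_column_bound[OF shift_wbound]) auto
    finally show ?thesis .
  qed
  thus ?thesis unfolding l2_iff_bounded by auto
qed

section \<open>Comparison of values of \<open>f\<close> with partial sums\<close>

context
  fixes m :: nat and W :: "nat \<Rightarrow> nat \<Rightarrow> nat \<Rightarrow> nat \<Rightarrow> nat \<Rightarrow> complex" and \<delta> :: real
    and v :: "nat \<Rightarrow> nat \<Rightarrow> complex" and t l :: nat
  assumes m: "0 < m" and W: "wbound d n m W \<delta>" "0 \<le> \<delta>" "\<delta> \<le> \<rho>"
    and v: "\<And>s i. s < m \<Longrightarrow> v s i = (if s = t \<and> i = l then 1 else 0) + feedback m (1 / \<rho>) W v s i"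
    and t: "t < m" and l: "l < n"
begin

text \<open>The relation \<open>f(X) T = T f(G)\<close> is applied to
  \<open>sum_b e_b (x) e_b\<close> over the roots. On the left this yields the column
  \<open>t * n + l\<close> of \<open>f(X)\<close>; on the right the first \<open>I\<close> columns
  of \<open>T\<close> give the partial sum and the others give
  \<open>\<epsilon> * R\<close>.\<close>

lemma partial_expansion_error:
  assumes I: "n \<le> I" and eps: "0 < \<epsilon>"
    and tail: "\<And>M. (\<Sum>s<m. \<Sum>i<M. if i < I then 0 else (cmod (v s i))\<^sup>2) \<le> \<epsilon>\<^sup>2"
    and s: "s < m" and k: "k < n"
  shows "cmod ((\<Sum>i<I. expansion_coeff k i * v s i) - f (tup d n Y m W) $$ (s * n + k, t * n + l)) \<le> \<epsilon> * (\<bar>B\<bar> * sqrt n)"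
proof -
  let ?X = "tup d n Y m W" and ?A = "I + m"
  define G where "G = tup d n Y (I + m) (augment I \<rho> \<epsilon> v W)"
  define T where "T = (\<lambda>s b. if b < I then v s b else if b - I = s then of_real \<epsilon> else 0)"
  note aug = augment_wbound[OF eps tail W]
  note X = tup_mem(2)[OF m W(1,2) le_less_trans[OF W(3) rho_less(2)]]
  have nn: "0 \<le> 2 * \<rho> * d * n" using \<rho>(1) by simp
  have G: "G \<in> \<Omega>" unfolding G_def using m by (intro tup_mem(2)[OF _ aug nn \<rho>(2)]) simp
  have vr: "v s i = feedback m (1 / \<rho>) W v s i" if "s < m" "n \<le> i" for s i
    using v[OF that(1), of i] that l by simp
  \<comment> \<open>At the roots \<open>T\<close> is zero except for a 1 at slot \<open>t\<close>,
    root \<open>l\<close>: this selects one column of \<open>f(X)\<close>.\<close>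
  have v0: "v c b = (if c = t then if b = l then 1 else 0 else 0)" if "c < m" "b < n" for c b
    using v[OF that(1), of b] that by (simp add: feedback_def)
  define F where "F c b = f G $$ (c * n + k, b * n + b)" for c b
  define R where "R = (\<Sum>b<n. F (I + s) b)"
  have "f ?X $$ (s * n + k, t * n + l) = (\<Sum>b<n. \<Sum>c<m. f ?X $$ (s * n + k, c * n + b) * T c b)"
  proof -
    have "(\<Sum>b<n. \<Sum>c<m. f ?X $$ (s * n + k, c * n + b) * T c b)
        = (\<Sum>b<n. \<Sum>c<m. if c = t then if b = l then f ?X $$ (s * n + k, c * n + b) else 0 else 0)"
      using I by (intro sum.cong refl) (auto simp: T_def v0)
    thus ?thesis using t l by simp
  qed
  also have "\<dots> = (\<Sum>b<n. \<Sum>c<?A. T s c * F c b)"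
  proof (rule sum.cong[OF refl])
    fix b assume b: "b \<in> {..<n}"
    show "(\<Sum>c<m. f ?X $$ (s * n + k, c * n + b) * T c b) = (\<Sum>c<?A. T s c * F c b)"
      unfolding F_def G_def
    proof (rule tup_intertwining[OF f d_pos Y X G[unfolded G_def]])
      fix j p q a b assume "j < d" "p < n" "q < n" "a < m" "b < I + m"
      thus "(\<Sum>c<m. W j p q a c * T c b) = (\<Sum>c<I + m. T a c * augment I \<rho> \<epsilon> v W j p q c b)"
        unfolding T_def by (intro augment_intertwining eps \<rho>(1) I vr)
    qed (use b s k I in auto)
  qed
  also have "\<dots> = (\<Sum>c<?A. T s c * (\<Sum>b<n. F c b))"
    by (subst sum.swap) (simp add: sum_distrib_left)
  also have "\<dots> = (\<Sum>c<I. v s c * (\<Sum>b<n. F c b)) + (\<Sum>c<m. if c = s then \<epsilon> * (\<Sum>b<n. F (I + c) b) else 0)"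
    unfolding sum_lessThan_add by (intro arg_cong2[where f = "(+)"] sum.cong) (auto simp: T_def)
  also have "\<dots> = (\<Sum>c<I. v s c * (\<Sum>b<n. F c b)) + \<epsilon> * R"
    using s by (simp add: R_def)
  \<comment> \<open>The zero block of \<open>augment\<close> makes the leading corner of
    \<open>f G\<close> equal to \<open>f\<close> at the pure shift, which is independent of
    \<open>v\<close> and \<open>W\<close>.\<close>
  also have "(\<Sum>c<I. v s c * (\<Sum>b<n. F c b)) = (\<Sum>i<I. expansion_coeff k i * v s i)"
  proof (intro sum.cong refl)
    fix i assume i: "i \<in> {..<I}"
    have I0: "0 < I" using I n_pos by simp
    have "f (tup d n Y I (shift \<rho>)) $$ (i * n + k, b * n + b) = F i b" if "b < n" for b
      unfolding F_def G_def
    proof (rule tup_truncation[OF f Y shift_mem[OF I0] G[unfolded G_def]])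
      show "augment I \<rho> \<epsilon> v W j p q a b = (if b < I then shift \<rho> j p q a b else 0)" if "a < I" for j p q a b
        using that by (simp add: augment_def)
    qed (use i k that I in auto)
    thus "v s i * (\<Sum>b<n. F i b) = expansion_coeff k i * v s i"
      using expansion_coeff_truncation[OF I _ k, of i] i by simp
  qed
  finally have eq: "f ?X $$ (s * n + k, t * n + l) = (\<Sum>i<I. expansion_coeff k i * v s i) + \<epsilon> * R" .
  \<comment> \<open>\<open>R\<close> is a coordinate of \<open>f G\<close> applied to a vector of
    norm \<open>sqrt n\<close>, hence bounded independently of the cut.\<close>
  let ?g = "\<lambda>a p. (cmod (\<Sum>l<n. f G $$ (a * n + p, l * n + l)))\<^sup>2"
  have "(cmod R)\<^sup>2 \<le> (\<Sum>p<n. ?g (I + s) p)"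
    unfolding R_def F_def using k by (intro member_le_sum[of k "{..<n}" "?g (I + s)"]) auto
  also have "\<dots> \<le> (\<Sum>a<?A. \<Sum>p<n. ?g a p)"
    using s by (intro member_le_sum[of "I + s" "{..<?A}" "\<lambda>a. \<Sum>p<n. ?g a p"]) (auto intro: sum_nonneg)
  also have "\<dots> \<le> B\<^sup>2 * n"
    unfolding G_def using I by (intro diagonal_column_bound[OF aug nn \<rho>(2)]) simp
  finally have "cmod R \<le> sqrt (B\<^sup>2 * n)" by (rule real_le_rsqrt)
  hence "\<epsilon> * cmod R \<le> \<epsilon> * (\<bar>B\<bar> * sqrt n)" using eps by (simp add: real_sqrt_mult)
  thus ?thesis unfolding eq using eps by (simp add: norm_mult)
qed

lemma expansion_sums:
  assumes l2: "\<And>s. s < m \<Longrightarrow> v s \<in> l2" and s: "s < m" and k: "k < n"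
  shows "(\<lambda>i. expansion_coeff k i * v s i) sums (f (tup d n Y m W) $$ (s * n + k, t * n + l))"
proof -
  define \<tau> where "\<tau> I = (\<Sum>s<m. (\<Sum>i. (cmod (v s i))\<^sup>2) - (\<Sum>i<I. (cmod (v s i))\<^sup>2))" for I
  \<comment> \<open>The extra \<open>1 / real (Suc I)\<close> keeps \<open>\<epsilon> I\<close>
    positive when the tail vanishes, since the augmented point divides by it.\<close>
  define \<epsilon> where "\<epsilon> I = sqrt (\<tau> I + 1 / real (Suc I))" for I
  have sm: "summable (\<lambda>i. (cmod (v s i))\<^sup>2)" if "s < m" for s using l2[OF that] by (simp add: l2_def)
  have tail: "(\<Sum>s<m. \<Sum>i<M. if i < I then 0 else (cmod (v s i))\<^sup>2) \<le> \<tau> I" for I M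
    unfolding \<tau>_def using sm by (intro sum_mono tail_sum_le) auto
  have "0 \<le> \<tau> I" for I using tail[of I 0] by simp
  hence eps: "0 < \<tau> I + 1 / real (Suc I)" for I by (simp add: add_nonneg_pos)
  have "\<tau> \<longlonglongrightarrow> (\<Sum>s<m. (\<Sum>i. (cmod (v s i))\<^sup>2) - (\<Sum>i. (cmod (v s i))\<^sup>2))"
    unfolding \<tau>_def using sm by (intro tendsto_intros summable_LIMSEQ) auto
  hence "(\<lambda>I. \<tau> I + 1 / real (Suc I)) \<longlonglongrightarrow> 0 + 0"
    using LIMSEQ_inverse_real_of_nat by (intro tendsto_add) (simp_all add: inverse_eq_divide)
  from tendsto_real_sqrt[OF this] have "\<epsilon> \<longlonglongrightarrow> 0" unfolding \<epsilon>_def by simp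
  hence lim: "(\<lambda>I. \<epsilon> I * (\<bar>B\<bar> * sqrt n)) \<longlonglongrightarrow> 0" by (rule tendsto_mult_left_zero)
  have "cmod ((\<Sum>i<I. expansion_coeff k i * v s i) - f (tup d n Y m W) $$ (s * n + k, t * n + l))
      \<le> \<epsilon> I * (\<bar>B\<bar> * sqrt n)" if "n \<le> I" for I
  proof (rule partial_expansion_error[OF that _ _ s k])
    show "0 < \<epsilon> I" using eps by (simp add: \<epsilon>_def)
    fix M
    have "(\<epsilon> I)\<^sup>2 = \<tau> I + 1 / real (Suc I)" using eps[of I] by (simp add: \<epsilon>_def)
    thus "(\<Sum>s<m. \<Sum>i<M. if i < I then 0 else (cmod (v s i))\<^sup>2) \<le> (\<epsilon> I)\<^sup>2"
      using tail[of I M] by (smt (verit) divide_nonneg_nonneg of_nat_0_le_iff)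
  qed
  hence "(\<lambda>I. (\<Sum>i<I. expansion_coeff k i * v s i) - f (tup d n Y m W) $$ (s * n + k, t * n + l)) \<longlonglongrightarrow> 0"
    by (intro tendsto_norm_zero_cancel[OF tendsto_sandwich[OF _ _ tendsto_const lim]])
       (auto intro: eventually_sequentiallyI[of n])
  thus ?thesis unfolding sums_def by (rule LIM_zero_cancel)
qed

end

end

section \<open>The realization near the centre\<close>

lemma centre_in_ubasic:
  assumes "0 < d" "0 < n" "length Y = d" "\<forall>M\<in>set Y. M \<in> carrier_mat n n" "0 < r"
  shows "Y \<in> ubasic d Y r"
proof -
  have "tup d n Y 1 (\<lambda>_ _ _ _ _. 0) \<in> ubasic d Y r"
    using assms by (intro tup_in_ubasic[where s = 0]) (auto simp: wbound_def)
  also have "tup d n Y 1 (\<lambda>_ _ _ _ _. 0) = Y"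
  proof (rule nth_equalityI)
    fix j assume "j < length (tup d n Y 1 (\<lambda>_ _ _ _ _. 0))"
    hence "j < d" "Y ! j \<in> carrier_mat n n" using assms by (auto simp: tup_def)
    thus "tup d n Y 1 (\<lambda>_ _ _ _ _. 0) ! j = Y ! j"
      by (auto intro!: eq_matI simp: tup_def wmat_def ampl_def Let_def)
  qed (use assms in \<open>simp add: tup_def\<close>)
  finally show ?thesis .
qed

theorem mainTheorem13:
  fixes d n :: nat
    and Y :: "complex mat list"
    and \<Omega> :: "complex mat list set"
    and f :: "complex mat list \<Rightarrow> complex mat"
  assumes "0 < d" and "0 < n"
    and "length Y = d" and "\<forall>M\<in>set Y. M \<in> carrier_mat n n"
    and "Y \<in> \<Omega>"
    and "uniformly_analytic d \<Omega> f"
  shows "\<exists>(A :: nat \<Rightarrow> complex mat \<Rightarrow> (nat \<Rightarrow> complex) \<Rightarrow> (nat \<Rightarrow> complex))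
           (b :: nat \<Rightarrow> nat \<Rightarrow> complex) (c :: nat \<Rightarrow> nat \<Rightarrow> complex) U.
           (\<forall>j<d. lin_to_ops n (A j)) \<and> (\<forall>k<n. b k \<in> l2 \<and> c k \<in> l2) \<and>
           uopen d U \<and> Y \<in> U \<and> U \<subseteq> \<Omega> \<and>
           (\<forall>X\<in>U. \<exists>m. level X = m * n \<and>
              bij_betw (LA d n A m (tsub X (map (ampl m) Y))) (l2m m) (l2m m) \<and>
              f X = realization d n A b c m (tsub X (map (ampl m) Y)))"
proof -
  note Y = assms(3,4)
  have f: "nc_function d \<Omega> f" using assms(6) by (simp add: uniformly_analytic_def)
  obtain U0 B where U0: "uopen d U0" "Y \<in> U0" "U0 \<subseteq> \<Omega>" and B: "\<forall>Z\<in>U0. opnorm (f Z) \<le> B"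
    using assms(5,6) unfolding uniformly_analytic_def by blast
  obtain r where r: "0 < r" "ubasic d Y r \<subseteq> U0" using uopen_ball[OF assms(1) U0(1,2)] by blast
  \<comment> \<open>The 3 gives \<open>2 * \<rho> * d * n = 2 * r / 3\<close>, below the radius
    \<open>r\<close>.\<close>
  define \<rho> where "\<rho> = r / (3 * d * n)"
  \<comment> \<open>Now \<open>(1 / \<rho>)\<^sup>2 * n * \<delta>\<^sup>2 = 1 / (4 * n)\<close>,
    small enough for the pencil, and \<open>\<delta> \<le> \<rho>\<close>, as the augmented point
    requires.\<close>
  define \<delta> where "\<delta> = \<rho> / (2 * n)"
  have \<rho>: "0 < \<rho>" "2 * \<rho> * d * n < r"
    using r assms(1,2) by (simp_all add: \<rho>_def field_simps)
  interpret nc_expansion d n Y \<Omega> f r B \<rho>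
    by unfold_locales (use assms f r U0 B \<rho> in auto)
  have \<delta>: "0 < \<delta>" "\<delta> \<le> \<rho>"
    using \<rho>(1) assms(2) by (simp_all add: \<delta>_def field_simps)
  have small: "(1 / \<rho>)\<^sup>2 * n * \<delta>\<^sup>2 \<le> 1 / 4"
    using \<rho>(1) assms(2) by (simp add: \<delta>_def power2_eq_square field_simps)
  define U where "U = ubasic d Y \<delta>"
  \<comment> \<open>The conjugate undoes the one that \<open>l2inner\<close> applies to its first
    argument.\<close>
  define b where "b k i = cnj (expansion_coeff k i)" for k i
  define c where "c k i = (if i = k then 1 else 0 :: complex)" for k i :: nat
  have Yn: "Y \<in> ncpts d" using assms(2-4) by (auto simp: ncpts_def)
  have c: "c k \<in> l2" for k
  proof -
    have "(\<lambda>i. (cmod (c k i))\<^sup>2) = (\<lambda>i. if i = k then 1 else 0)" by (auto simp: c_def)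
    thus ?thesis unfolding l2_def by (simp add: summable_single)
  qed
  have "\<exists>m. level X = m * n \<and>
      bij_betw (LA d n (coeff_op (1 / \<rho>)) m (tsub X (map (ampl m) Y))) (l2m m) (l2m m) \<and>
      f X = realization d n (coeff_op (1 / \<rho>)) b c m (tsub X (map (ampl m) Y))" if X: "X \<in> U" for X
  proof -
    obtain m W where m: "0 < m" "level X = m * n" and XW: "X = tup d n Y m W"
      and Z: "tsub X (map (ampl m) Y) = map (wmat n m W) [0..<d]" and W: "wbound d n m W \<delta>"
      using ubasic_tupE[OF assms(1,2) Y X[unfolded U_def]] by metis
    let ?L = "LA d n (coeff_op (1 / \<rho>)) m (map (wmat n m W) [0..<d])"
    note bij = LA_bij[OF W small]
    have entry: "l2inner (b k) (the_inv_into (l2m m) ?L (slot t (c l)) s) = f X $$ (s * n + k, t * n + l)"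
      if "s < m" "t < m" "k < n" "l < n" for s t k l
    proof -
      have "slot t (c l) \<in> l2m m" using that c by (auto simp: l2m_def slot_def l2_def)
      from LA_preimage[OF W small this] obtain v where v: "v \<in> l2m m" "?L v = slot t (c l)"
        and veq: "\<And>s i. s < m \<Longrightarrow> v s i = slot t (c l) s i + feedback m (1 / \<rho>) W v s i" by blast
      \<comment> \<open>Bijectivity of the pencil identifies the vector in the realization formula
        with the solution whose recursion is known.\<close>
      have inv: "the_inv_into (l2m m) ?L (slot t (c l)) = v"
        using bij v by (intro the_inv_into_f_eq) (auto simp: bij_betw_def)
      have v': "v s i = (if s = t \<and> i = l then 1 else 0) + feedback m (1 / \<rho>) W v s i" if "s < m" for s i
        using veq[OF that, of i] by (simp add: slot_def c_def)
      have "v s \<in> l2" if "s < m" for s using v(1) that by (simp add: l2m_def)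
      note expansion_sums[OF m(1) W less_imp_le[OF \<delta>(1)] \<delta>(2) v' that(2,4) this that(1,3)]
      then show ?thesis unfolding inv l2inner_def b_def XW by (simp add: sums_iff)
    qed
    have "X \<in> \<Omega>" using X ubasic_mono[of \<delta> r d Y] \<delta> rho_less(2) r U0 by (auto simp: U_def)
    hence "f X \<in> carrier_mat (m * n) (m * n)" using f m by (auto simp: nc_function_def)
    moreover have "x div n < m" "x mod n < n" if "x < m * n" for x
      using that assms(2) by (auto simp: less_mult_imp_div_less)
    ultimately have "f X = realization d n (coeff_op (1 / \<rho>)) b c m (map (wmat n m W) [0..<d])"
      by (intro eq_matI) (auto simp: realization_def entry)
    thus ?thesis using m bij Z by metis
  qed
  moreover have "uopen d U"
    using Yn \<delta>(1) by (auto simp: uopen_def U_def ubasics_def ubasic_def intro!: generate_topology.Basis)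
  moreover have "Y \<in> U" unfolding U_def using assms(1,2) Y \<delta>(1) by (rule centre_in_ubasic)
  moreover have "U \<subseteq> \<Omega>" using ubasic_mono[of \<delta> r d Y] \<delta> rho_less(2) r U0 by (auto simp: U_def)
  moreover have "\<forall>j<d. lin_to_ops n (coeff_op (1 / \<rho>) j)" using lin_to_ops_coeff_op by blast
  moreover have "\<forall>k<n. b k \<in> l2 \<and> c k \<in> l2" using expansion_coeff_l2 c unfolding b_def by blast
  ultimately show ?thesis by blast
qed

end
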